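(* Let $d\geq 3$ and let $\mathcal{F}_d=V(x^d+y^d+z^d)\subset\mathbb{P}^2$ be the Fermat curve of degree $d$ over $\mathbb{C}$. Let $u$ be a primitive $2d$-th root of unity (so $u^d=-1$) and $\zeta$ a primitive $d$-th root of unity. For $j\in\{0,\dots,d-1\}$ and $k$ odd with $0<k<2d$, let $s_{j,k}=(\zeta^j:1:u^{-k}2^{1/d})$, which is a sextactic point of $\mathcal{F}_d$ lying on $\mathcal{B}_z=V(x^d-y^d)$. Then the hyperosculating conic to $\mathcal{F}_d$ at $s_{j,k}$ is the zero set of the polynomial \begin{align*} O_{j,k}=\;&d(d+1)\zeta^{-2j}x^2+d(d+1)y^2-4(d+1)(2d-3)u^{2k}2^{-2/d}z^2\\ &-2(d-2)(5d-3)\zeta^{-j}xy+8d(d-2)\zeta^{-j}u^{k}2^{-1/d}xz+8d(d-2)u^{k}2^{-1/d}yz. \end{align*}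
   Context: The osculating conic $O_p$ to $\mathcal{F}_d$ at $p$ is the unique conic with intersection multiplicity $(O_p.\mathcal{F}_d)_p\geq 5$; it is hyperosculating if $(O_p.\mathcal{F}_d)_p\geq 6$. An inflection point is a point $p$ whose tangent line meets $\mathcal{F}_d$ at $p$ with multiplicity at least $3$. A sextactic point is a point of $\mathcal{F}_d$ that is not an inflection point and at which the osculating conic is hyperosculating. $2^{1/d}$ denotes the positive real $d$-th root of $2$. *)

theory Defs
  imports "HOL-Analysis.Analysis" "HOL-Computational_Algebra.Computational_Algebra"
begin

definition primitive_root_of_unity :: "nat \<Rightarrow> complex \<Rightarrow> bool" where
  "primitive_root_of_unity n w \<longleftrightarrow> n > 0 \<and> w ^ n = 1 \<and> (\<forall>m. 0 < m \<and> m < n \<longrightarrow> w ^ m \<noteq> 1)"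

text \<open>
  The ring \<open>\<complex>[x,y,z]\<close> is represented as \<open>\<complex>[x][y][z]\<close>: the innermost polynomial
  variable is \<open>x\<close>, the outermost one is \<open>z\<close>.
\<close>

type_synonym poly3 = "complex poly poly poly"

definition const3 :: "complex \<Rightarrow> poly3" where "const3 c = [:[:[:c:]:]:]"
definition X3 :: poly3 where "X3 = [:[:[:0, 1:]:]:]"
definition Y3 :: poly3 where "Y3 = [:[:0, 1:]:]"
definition Z3 :: poly3 where "Z3 = [:0, 1:]"

definition eval3 :: "poly3 \<Rightarrow> complex ^ 3 \<Rightarrow> complex" where
  "eval3 F v = poly (poly (poly F [:[:v $ 3:]:]) [:v $ 2:]) (v $ 1)"

text \<open>The zero polynomial is homogeneous of every degree.\<close>

definition homogeneous :: "nat \<Rightarrow> poly3 \<Rightarrow> bool" where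
  "homogeneous n F \<longleftrightarrow>
     (\<forall>i j k. coeff (coeff (coeff F k) j) i \<noteq> 0 \<longrightarrow> i + j + k = n)"

definition dX :: "poly3 \<Rightarrow> poly3" where "dX F = map_poly (map_poly pderiv) F"
definition dY :: "poly3 \<Rightarrow> poly3" where "dY F = map_poly pderiv F"
definition dZ :: "poly3 \<Rightarrow> poly3" where "dZ F = pderiv F"

definition proj_rel :: "complex ^ 3 \<Rightarrow> complex ^ 3 \<Rightarrow> bool" where
  "proj_rel v w \<longleftrightarrow> v \<noteq> 0 \<and> w \<noteq> 0 \<and> (\<exists>c. c \<noteq> 0 \<and> w = c *s v)"

lemma proj_rel_part_equivp: "part_equivp proj_rel"
proof (rule part_equivpI)
  show "\<exists>v. proj_rel v v"
    unfolding proj_rel_def by (rule exI[of _ 1]) (auto intro!: exI[of _ 1])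
  show "symp proj_rel"
  proof (rule sympI)
    fix v w assume "proj_rel v w"
    then obtain c where c: "v \<noteq> 0" "w \<noteq> 0" "c \<noteq> 0" "w = c *s v"
      unfolding proj_rel_def by blast
    then have "v = inverse c *s w" by (simp add: vector_smult_assoc)
    with c show "proj_rel w v" unfolding proj_rel_def
      by (metis inverse_nonzero_iff_nonzero)
  qed
  show "transp proj_rel"
  proof (rule transpI)
    fix u v w assume "proj_rel u v" "proj_rel v w"
    then obtain b c where "u \<noteq> 0" "w \<noteq> 0" "b \<noteq> 0" "c \<noteq> 0" "v = b *s u" "w = c *s v"
      unfolding proj_rel_def by blast
    then show "proj_rel u w" unfolding proj_rel_def
      by (auto simp: vector_smult_assoc intro!: exI[of _ "c * b"])
  qed
qed

quotient_type proj_plane = "complex ^ 3" / partial: proj_rel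
  by (rule proj_rel_part_equivp)

definition represents :: "complex ^ 3 \<Rightarrow> proj_plane \<Rightarrow> bool" where
  "represents v p \<longleftrightarrow> v \<noteq> 0 \<and> p = abs_proj_plane v"

text \<open>\<open>hpoint a b c\<close> is the point \<open>(a : b : c)\<close>; it is meaningful only if \<open>(a, b, c) \<noteq> 0\<close>.\<close>

definition hpoint :: "complex \<Rightarrow> complex \<Rightarrow> complex \<Rightarrow> proj_plane" where
  "hpoint a b c = abs_proj_plane (vector [a, b, c])"

definition vanishes_at :: "poly3 \<Rightarrow> proj_plane \<Rightarrow> bool" where
  "vanishes_at F p \<longleftrightarrow> (\<forall>v. represents v p \<longrightarrow> eval3 F v = 0)"

definition zero_set :: "poly3 \<Rightarrow> proj_plane set" where
  "zero_set F = {p. vanishes_at F p}"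

text \<open>
  The local ring of \<open>\<P>\<^sup>2\<close> at \<open>p\<close>, as a subring of the fraction field of \<open>\<complex>[x,y,z]\<close>, and the
  local equations at \<open>p\<close> of the curve defined by a form \<open>F\<close>.  Any two local equations differ
  by a unit of the local ring, so \<open>local_ideal F G p\<close> is the ideal generated by
  any choice of local equations of \<open>F\<close> and \<open>G\<close>.
\<close>

definition local_ring :: "proj_plane \<Rightarrow> poly3 fract set" where
  "local_ring p =
     {to_fract A / to_fract B | A B n. homogeneous n A \<and> homogeneous n B \<and> \<not> vanishes_at B p}"

definition local_equations :: "poly3 \<Rightarrow> proj_plane \<Rightarrow> poly3 fract set" where
  "local_equations F p =
     {to_fract F / to_fract B | B n. homogeneous n F \<and> homogeneous n B \<and> \<not> vanishes_at B p}"

definition local_ideal :: "poly3 \<Rightarrow> poly3 \<Rightarrow> proj_plane \<Rightarrow> poly3 fract set" where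
  "local_ideal F G p =
     {a * f + b * g | a b f g. a \<in> local_ring p \<and> b \<in> local_ring p \<and>
        f \<in> local_equations F p \<and> g \<in> local_equations G p}"

definition independent_mod :: "poly3 fract set \<Rightarrow> poly3 fract set \<Rightarrow> bool" where
  "independent_mod I S \<longleftrightarrow>
     (\<forall>c :: poly3 fract \<Rightarrow> complex.
        (\<Sum>s\<in>S. to_fract (const3 (c s)) * s) \<in> I \<longrightarrow> (\<forall>s\<in>S. c s = 0))"

text \<open>
  \<open>(F.G)\<^sub>p\<close> is the dimension over \<open>\<complex>\<close> of the local ring at \<open>p\<close> modulo the ideal generated by
  local equations of \<open>F\<close> and \<open>G\<close>, i.e. the supremum of the sizes of finite families
  whose classes are linearly independent.
\<close>

definition intersection_mult :: "poly3 \<Rightarrow> poly3 \<Rightarrow> proj_plane \<Rightarrow> enat" where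
  "intersection_mult F G p =
     Sup {enat (card S) | S. finite S \<and> S \<subseteq> local_ring p \<and> independent_mod (local_ideal F G p) S}"

text \<open>The tangent line exists only at smooth points, hence the condition on the gradient.\<close>

definition tangent_line :: "poly3 \<Rightarrow> proj_plane \<Rightarrow> poly3 \<Rightarrow> bool" where
  "tangent_line F p L \<longleftrightarrow> vanishes_at F p \<and>
     (\<exists>v. represents v p \<and>
        (eval3 (dX F) v \<noteq> 0 \<or> eval3 (dY F) v \<noteq> 0 \<or> eval3 (dZ F) v \<noteq> 0) \<and>
        L = const3 (eval3 (dX F) v) * X3 + const3 (eval3 (dY F) v) * Y3
              + const3 (eval3 (dZ F) v) * Z3)"

definition inflection_point :: "poly3 \<Rightarrow> proj_plane \<Rightarrow> bool" where
  "inflection_point F p \<longleftrightarrow> (\<exists>L. tangent_line F p L \<and> intersection_mult L F p \<ge> 3)"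

text \<open>Conics may be degenerate; a conic is given by a quadratic form up to a nonzero scalar.\<close>

definition conic :: "poly3 \<Rightarrow> bool" where
  "conic Q \<longleftrightarrow> homogeneous 2 Q \<and> Q \<noteq> 0"

definition osculating_conic :: "poly3 \<Rightarrow> proj_plane \<Rightarrow> poly3 \<Rightarrow> bool" where
  "osculating_conic F p Q \<longleftrightarrow> conic Q \<and> intersection_mult Q F p \<ge> 5 \<and>
     (\<forall>Q'. conic Q' \<and> intersection_mult Q' F p \<ge> 5 \<longrightarrow> (\<exists>c. c \<noteq> 0 \<and> Q' = const3 c * Q))"

definition hyperosculating_conic :: "poly3 \<Rightarrow> proj_plane \<Rightarrow> poly3 \<Rightarrow> bool" where
  "hyperosculating_conic F p Q \<longleftrightarrow> osculating_conic F p Q \<and> intersection_mult Q F p \<ge> 6"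

definition sextactic_point :: "poly3 \<Rightarrow> proj_plane \<Rightarrow> bool" where
  "sextactic_point F p \<longleftrightarrow> vanishes_at F p \<and> \<not> inflection_point F p \<and>
     (\<exists>Q. hyperosculating_conic F p Q)"

definition fermat :: "nat \<Rightarrow> poly3" where
  "fermat d = X3 ^ d + Y3 ^ d + Z3 ^ d"

definition s_point :: "nat \<Rightarrow> complex \<Rightarrow> complex \<Rightarrow> nat \<Rightarrow> nat \<Rightarrow> proj_plane" where
  "s_point d \<zeta> u j k =
     hpoint (\<zeta> ^ j) 1 (u powi (- int k) * complex_of_real (root d 2))"

definition O_conic :: "nat \<Rightarrow> complex \<Rightarrow> complex \<Rightarrow> nat \<Rightarrow> nat \<Rightarrow> poly3" where
  "O_conic d \<zeta> u j k =
     (let D = of_nat d :: complex; r = complex_of_real (root d 2) in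
       const3 (D * (D + 1) * \<zeta> powi (- 2 * int j)) * X3 ^ 2
     + const3 (D * (D + 1)) * Y3 ^ 2
     - const3 (4 * (D + 1) * (2 * D - 3) * u ^ (2 * k) * r powi (- 2)) * Z3 ^ 2
     - const3 (2 * (D - 2) * (5 * D - 3) * \<zeta> powi (- int j)) * (X3 * Y3)
     + const3 (8 * D * (D - 2) * \<zeta> powi (- int j) * u ^ k * r powi (- 1)) * (X3 * Z3)
     + const3 (8 * D * (D - 2) * u ^ k * r powi (- 1)) * (Y3 * Z3))"

end

theory Submission
  imports Defs
begin

text \<open>
  Rescale the coordinates by \<open>x = \<zeta>\<^sup>j x'\<close>, \<open>z = u\<^sup>-\<^sup>k 2\<^sup>1\<^sup>/\<^sup>d z'\<close>, so that the point becomes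
  \<open>(1:1:1)\<close> and, in the chart \<open>z' = 1\<close>, the curve becomes \<open>f = x'\<^sup>d + y'\<^sup>d - 2 = 0\<close>.  With \<open>x' = 1 + a + b\<close> and
  \<open>y' = 1 + a - b\<close> the tangent line is \<open>a = 0\<close>, the difference \<open>b\<close> is a local parameter of the
  curve, and Taylor expansion of \<open>f\<close> gives \<open>a = b\<^sup>2 e\<close> modulo \<open>f\<close> with a unit \<open>e\<close>; in particular the
  tangent meets the curve with multiplicity 2.  Since \<open>f\<close> is even in \<open>b\<close>, so is the osculating
  conic, and expanding \<open>f\<close> up to \<open>b\<^sup>6\<close> shows that a combination of \<open>a\<close>, \<open>b\<^sup>2\<close>, \<open>a\<^sup>2\<close> proportional to the
  stated polynomial lies in the ideal \<open>(b\<^sup>6, f)\<close>.  The quadratic forms are spanned by this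
  polynomial together with \<open>1, b, a, ab, a\<^sup>2\<close>, whose orders along the curve are the distinct numbers
  \<open>0, 1, 2, 3, 4\<close>, so no other conic has intersection multiplicity at least 5.
\<close>

section \<open>Forms in three variables\<close>

lemma X3_power: "X3 ^ n = [:[:[:0, 1:] ^ n:]:]"
  by (induction n) (simp_all add: X3_def one_pCons mult.commute)

lemma Y3_power: "Y3 ^ n = [:[:0, 1:] ^ n:]"
  by (induction n) (simp_all add: Y3_def one_pCons mult.commute)

lemma const3_monom: "monom (monom (monom c i) j) k = const3 c * X3 ^ i * Y3 ^ j * Z3 ^ k"
  by (simp add: X3_power Y3_power Z3_def const3_def monom_altdef mult.assoc)

text \<open>A form is the sum of its monomials, all of the same degree. Products, evaluations and
  local expansions of forms are thereby reduced to single monomials.\<close>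

lemma homogeneous_induct [consumes 1, case_names zero add monom]:
  assumes "homogeneous n F"
    and zero: "P 0"
    and add: "\<And>F G. P F \<Longrightarrow> P G \<Longrightarrow> P (F + G)"
    and mono: "\<And>c i j k. i + j + k = n \<Longrightarrow> P (const3 c * X3 ^ i * Y3 ^ j * Z3 ^ k)"
  shows "P F"
proof -
  have sum: "P (sum g A)" if "\<And>x. x \<in> A \<Longrightarrow> P (g x)" for g :: "nat \<Rightarrow> poly3" and A
    using that by (induction A rule: infinite_finite_induct) (auto intro: zero add)
  \<comment> \<open>Homogeneity constrains the exponents only where the coefficient is nonzero; the
    other summands are the zero polynomial.\<close>
  have *: "P (monom (monom (monom (coeff (coeff (coeff F k) j) i) i) j) k)" for i j k
  proof (cases "coeff (coeff (coeff F k) j) i = 0")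
    case False
    then show ?thesis
      using assms(1) mono[of i j k] by (simp add: const3_monom homogeneous_def)
  qed (simp add: zero)
  have monom_sum: "monom (sum g A) n = (\<Sum>x\<in>A. monom (g x) n)"
    for g :: "nat \<Rightarrow> 'b::comm_monoid_add" and A n
    by (induction A rule: infinite_finite_induct) (auto simp: add_monom[symmetric])
  have "F = (\<Sum>k\<le>degree F. monom (coeff F k) k)"
    by (simp add: poly_as_sum_of_monoms)
  also have "\<dots> = (\<Sum>k\<le>degree F. \<Sum>j\<le>degree (coeff F k). \<Sum>i\<le>degree (coeff (coeff F k) j).
      monom (monom (monom (coeff (coeff (coeff F k) j) i) i) j) k)"
    by (simp only: monom_sum[symmetric] poly_as_sum_of_monoms)
  finally have F: "F = \<dots>" .
  show ?thesis by (subst F) (intro sum *)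
qed

lemma eval3_simps [simp]:
  "eval3 0 v = 0" "eval3 1 v = 1"
  "eval3 (F + G) v = eval3 F v + eval3 G v"
  "eval3 (F - G) v = eval3 F v - eval3 G v"
  "eval3 (F * G) v = eval3 F v * eval3 G v"
  "eval3 (F ^ n) v = eval3 F v ^ n"
  "eval3 (const3 c) v = c" "eval3 X3 v = v $ 1" "eval3 Y3 v = v $ 2" "eval3 Z3 v = v $ 3"
  by (simp_all add: eval3_def const3_def X3_def Y3_def Z3_def)

lemma const3_hom:
  "const3 0 = 0" "const3 1 = 1" "const3 (a + b) = const3 a + const3 b"
  "const3 (a * b) = const3 a * const3 b"
  by (simp_all add: const3_def one_pCons)

lemma homogeneous_0 [simp]: "homogeneous n 0"
  by (simp add: homogeneous_def)

lemma homogeneous_add: "homogeneous n F \<Longrightarrow> homogeneous n G \<Longrightarrow> homogeneous n (F + G)"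
  unfolding homogeneous_def coeff_add by (metis add_0)

lemma homogeneous_diff: "homogeneous n F \<Longrightarrow> homogeneous n G \<Longrightarrow> homogeneous n (F - G)"
  unfolding homogeneous_def coeff_diff by (metis diff_self)

lemma homogeneous_monom: "homogeneous (i + j + k) (const3 c * X3 ^ i * Y3 ^ j * Z3 ^ k)"
  unfolding const3_monom[symmetric] homogeneous_def by auto

lemma homogeneous_mult:
  assumes "homogeneous m F" "homogeneous n G"
  shows "homogeneous (m + n) (F * G)"
  using assms(1)
proof (induction F rule: homogeneous_induct)
  case (monom c i j k)
  show ?case
    using assms(2)
  proof (induction G rule: homogeneous_induct)
    case (monom c' i' j' k')
    have "const3 c * X3 ^ i * Y3 ^ j * Z3 ^ k * (const3 c' * X3 ^ i' * Y3 ^ j' * Z3 ^ k')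
        = const3 (c * c') * X3 ^ (i + i') * Y3 ^ (j + j') * Z3 ^ (k + k')"
      by (simp only: power_add const3_hom mult_ac)
    moreover have "i + i' + (j + j') + (k + k') = m + n"
      using \<open>i + j + k = m\<close> monom by simp
    ultimately show ?case
      using homogeneous_monom[of "i + i'" "j + j'" "k + k'" "c * c'"] by simp
  qed (simp_all add: distrib_left homogeneous_add)
qed (simp_all add: distrib_right homogeneous_add)

lemma homogeneous_const3 [simp]: "homogeneous 0 (const3 c)"
  using homogeneous_monom[of 0 0 0 c] by simp

lemma homogeneous_1 [simp]: "homogeneous 0 1"
  using homogeneous_const3[of 1] by (simp add: const3_hom)

lemma homogeneous_XYZ [simp]:
  "homogeneous (Suc 0) X3" "homogeneous (Suc 0) Y3" "homogeneous (Suc 0) Z3"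
  using homogeneous_monom[of 1 0 0 1] homogeneous_monom[of 0 1 0 1] homogeneous_monom[of 0 0 1 1]
  by (simp_all add: const3_hom)

lemma homogeneous_const_mult: "homogeneous n F \<Longrightarrow> homogeneous n (const3 c * F)"
  using homogeneous_mult[of 0 "const3 c" n F] by simp

lemma homogeneous_power: "homogeneous (Suc 0) F \<Longrightarrow> homogeneous n (F ^ n)"
proof (induction n)
  case 0
  then show ?case by simp
next
  case (Suc n)
  then show ?case using homogeneous_mult[of "Suc 0" F n "F ^ n"] by simp
qed

text \<open>The exponents of any nonzero coefficient add up to the degree. This removes the freedom
  in the degree that \<open>local_equations\<close> quantifies over.\<close>

lemma homogeneous_unique: "homogeneous m F \<Longrightarrow> homogeneous n F \<Longrightarrow> F \<noteq> 0 \<Longrightarrow> m = n"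
  unfolding homogeneous_def by (metis leading_coeff_0_iff)

section \<open>Values of forms at projective points\<close>

lemma eval3_scale:
  assumes "homogeneous n F"
  shows "eval3 F (c *s v) = c ^ n * eval3 F v"
  using assms
  by (induction F rule: homogeneous_induct)
    (auto simp: distrib_left power_add power_mult_distrib)

text \<open>The middle coordinate 1 keeps the vector nonzero, hence inside the domain of the partial
  quotient, where equality of classes is the same as \<open>proj_rel\<close>.\<close>

lemma represents_hpoint_iff:
  "represents w (hpoint a 1 b) \<longleftrightarrow> (\<exists>c. c \<noteq> 0 \<and> w = c *s vector [a, 1, b])"
proof -
  let ?v = "vector [a, 1, b] :: complex ^ 3"
  have v: "?v \<noteq> 0"
    by (auto simp: vec_eq_iff intro!: exI[of _ 2])
  have refl: "proj_rel w w" if "w \<noteq> 0" for w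
    using that by (auto simp: proj_rel_def intro: exI[of _ 1])
  have "abs_proj_plane w = abs_proj_plane ?v \<longleftrightarrow> proj_rel w ?v" if "w \<noteq> 0"
    using Quotient3_rel[OF Quotient3_proj_plane] refl[OF that] refl[OF v] by blast
  moreover have "proj_rel w ?v \<longleftrightarrow> proj_rel ?v w" if "w \<noteq> 0"
    using part_equivp_symp[OF proj_rel_part_equivp] by blast
  ultimately show ?thesis
    unfolding represents_def hpoint_def using v by (auto simp: proj_rel_def)
qed

lemma vanishes_at_hpoint_iff:
  assumes "homogeneous n F"
  shows "vanishes_at F (hpoint a 1 b) \<longleftrightarrow> eval3 F (vector [a, 1, b]) = 0"
proof
  assume "vanishes_at F (hpoint a 1 b)"
  moreover have "represents (vector [a, 1, b]) (hpoint a 1 b)"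
    unfolding represents_hpoint_iff by (rule exI[of _ 1]) simp
  ultimately show "eval3 F (vector [a, 1, b]) = 0"
    unfolding vanishes_at_def by blast
next
  assume "eval3 F (vector [a, 1, b]) = 0"
  then show "vanishes_at F (hpoint a 1 b)"
    unfolding vanishes_at_def represents_hpoint_iff
    by (metis eval3_scale[OF assms] mult_zero_right)
qed

section \<open>Orders along a smooth branch in a local ring\<close>

text \<open>Gaussian elimination: each induction step uses one vector as pivot to clear the last
  coordinate of all others, so \<open>n\<close> coordinates cost at most \<open>n\<close>
  vectors.\<close>

lemma nontrivial_linear_relation:
  fixes v :: "'b \<Rightarrow> nat \<Rightarrow> 'c::field"
  assumes "finite S" "n < card S"
  shows "\<exists>l. (\<exists>s\<in>S. l s \<noteq> 0) \<and> (\<forall>i<n. (\<Sum>s\<in>S. l s * v s i) = 0)"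
  using assms
proof (induction n arbitrary: S v)
  case 0
  then have "S \<noteq> {}" by auto
  then show ?case by (intro exI[of _ "\<lambda>_. 1"]) auto
next
  case (Suc n)
  show ?case
  proof (cases "\<forall>s\<in>S. v s n = 0")
    case True
    from Suc.IH[of S v] Suc.prems obtain l where
      "\<exists>s\<in>S. l s \<noteq> 0" "\<forall>i<n. (\<Sum>s\<in>S. l s * v s i) = 0" by auto
    with True show ?thesis
      by (intro exI[of _ l]) (auto simp: less_Suc_eq intro!: sum.neutral)
  next
    case False
    then obtain s0 where s0: "s0 \<in> S" "v s0 n \<noteq> 0" by blast
    let ?T = "S - {s0}"
    define w where "w s i = v s i - v s n / v s0 n * v s0 i" for s i
    have "n < card ?T" "finite ?T" using Suc.prems s0 by (auto simp: card_Diff_singleton)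
    from Suc.IH[OF this(2,1), of w] obtain l where
      l: "\<exists>s\<in>?T. l s \<noteq> 0" "\<And>i. i < n \<Longrightarrow> (\<Sum>s\<in>?T. l s * w s i) = 0" by blast
    \<comment> \<open>The relation among the reduced vectors \<open>w s\<close> becomes one among
      the \<open>v s\<close> once all subtracted multiples of the pivot are collected in the
      coefficient of \<open>s0\<close>.\<close>
    define c where "c = - (\<Sum>s\<in>?T. l s * v s n) / v s0 n"
    have "(\<Sum>s\<in>S. (l(s0 := c)) s * v s i) = (\<Sum>s\<in>?T. l s * w s i)" for i
    proof -
      have "(\<Sum>s\<in>S. (l(s0 := c)) s * v s i) = c * v s0 i + (\<Sum>s\<in>?T. l s * v s i)"
        using Suc.prems s0 by (simp add: sum.remove[of S s0])
      also have "c * v s0 i = - (\<Sum>s\<in>?T. l s * (v s n / v s0 n * v s0 i))"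
        unfolding c_def minus_divide_left[symmetric] mult_minus_left sum_divide_distrib sum_distrib_right
        by (intro arg_cong[of _ _ uminus] sum.cong) simp_all
      finally show ?thesis
        by (simp add: w_def right_diff_distrib sum_subtractf)
    qed
    moreover have "w s n = 0" for s using s0 by (simp add: w_def)
    ultimately show ?thesis
      using l by (intro exI[of _ "l(s0 := c)"]) (auto simp: less_Suc_eq)
  qed
qed

text \<open>
  \<open>R\<close> is a local ring with maximal ideal \<open>M\<close> and residue field \<open>\<complex>\<close>, embedded by \<open>k\<close>.
\<close>

locale local_algebra =
  fixes R M :: "'a::field set" and k :: "complex \<Rightarrow> 'a"
  assumes k_1: "k 1 = 1" and k_add: "k (c + c') = k c + k c'" and k_mult: "k (c * c') = k c * k c'"
    and k_in: "k c \<in> R"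
    and add_in: "x \<in> R \<Longrightarrow> y \<in> R \<Longrightarrow> x + y \<in> R"
    and mult_in: "x \<in> R \<Longrightarrow> y \<in> R \<Longrightarrow> x * y \<in> R"
    and M_subset: "M \<subseteq> R"
    and M_add: "x \<in> M \<Longrightarrow> y \<in> M \<Longrightarrow> x + y \<in> M"
    and M_mult: "x \<in> M \<Longrightarrow> y \<in> R \<Longrightarrow> x * y \<in> M"
    and k_in_M: "k c \<in> M \<Longrightarrow> c = 0"
    and inverse_in: "x \<in> R \<Longrightarrow> x \<notin> M \<Longrightarrow> inverse x \<in> R"
    and residue: "x \<in> R \<Longrightarrow> \<exists>c. x - k c \<in> M"
begin

lemma k_0: "k 0 = 0"
  by (metis add.right_neutral add_left_cancel k_add)

lemma k_minus: "k (- c) = - k c"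
  using k_add[of c "- c"] by (simp add: k_0 eq_neg_iff_add_eq_0 add.commute)

lemma k_diff: "k (c - c') = k c - k c'"
  using k_add[of c "- c'"] by (simp add: k_minus)

lemma k_of_nat: "k (of_nat n) = of_nat n"
  by (induction n) (simp_all add: k_0 k_1 k_add)

lemma k_numeral: "k (numeral n) = numeral n"
  using k_of_nat[of "numeral n"] by simp

lemma k_power: "k (c ^ n) = k c ^ n"
  by (induction n) (simp_all add: k_1 k_mult)

lemma k_sum: "k (sum g A) = (\<Sum>x\<in>A. k (g x))"
  by (induction A rule: infinite_finite_induct) (simp_all add: k_0 k_add)

lemma zero_in: "0 \<in> R" and one_in: "1 \<in> R" and of_nat_in: "of_nat n \<in> R"
  and numeral_in: "numeral m \<in> R"
  using k_in[of 0] k_in[of 1] k_in[of "of_nat n"] k_in[of "numeral m"]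
  by (simp_all add: k_0 k_1 k_of_nat k_numeral)

lemma uminus_in: "x \<in> R \<Longrightarrow> - x \<in> R"
  using mult_in[OF k_in[of "- 1"], of x] by (simp add: k_minus k_1)

lemma diff_in: "x \<in> R \<Longrightarrow> y \<in> R \<Longrightarrow> x - y \<in> R"
  using add_in[of x "- y"] by (simp add: uminus_in)

lemma power_in: "x \<in> R \<Longrightarrow> x ^ n \<in> R"
  by (induction n) (auto intro: one_in mult_in)

lemma sum_in: "(\<And>x. x \<in> A \<Longrightarrow> g x \<in> R) \<Longrightarrow> sum g A \<in> R"
  by (induction A rule: infinite_finite_induct) (auto intro: zero_in add_in)

lemma M_in: "x \<in> M \<Longrightarrow> x \<in> R"
  using M_subset by blast

lemmas in_intros = k_in add_in mult_in zero_in one_in of_nat_in numeral_in uminus_in diff_in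
  power_in sum_in

lemma M_mult': "x \<in> R \<Longrightarrow> y \<in> M \<Longrightarrow> x * y \<in> M"
  using M_mult[of y x] by (simp add: mult.commute)

lemma M_uminus: "x \<in> M \<Longrightarrow> - x \<in> M"
  using M_mult[of x "- 1"] by (simp add: uminus_in one_in)

lemma M_diff: "x \<in> M \<Longrightarrow> y \<in> M \<Longrightarrow> x - y \<in> M"
  using M_add[of x "- y"] by (simp add: M_uminus)

lemma unit_add_M: "x \<in> R \<Longrightarrow> x \<notin> M \<Longrightarrow> y \<in> M \<Longrightarrow> x + y \<notin> M"
  using M_diff[of "x + y" y] by auto

lemma k_unit: "c \<noteq> 0 \<Longrightarrow> k c \<notin> M"
  using k_in_M by blast

lemma unit_mult: "x \<in> R \<Longrightarrow> x \<notin> M \<Longrightarrow> y \<in> R \<Longrightarrow> y \<notin> M \<Longrightarrow> x * y \<notin> M"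
proof
  assume *: "x \<in> R" "x \<notin> M" "y \<in> R" "y \<notin> M" "x * y \<in> M"
  then have "x * y * inverse y \<in> M" using M_mult inverse_in by blast
  moreover have "y \<noteq> 0" using * M_mult'[of 0 "x * y"] by (auto intro: in_intros)
  ultimately show False using * by (simp add: mult.assoc)
qed

text \<open>The case \<open>p = 0\<close> gives the principal ideal of \<open>q\<close>; a
  difference lying in \<open>ideal2 0 f\<close> is the form in which congruence modulo
  \<open>f\<close> appears below.\<close>

definition ideal2 :: "'a \<Rightarrow> 'a \<Rightarrow> 'a set" where
  "ideal2 p q = {x * p + y * q | x y. x \<in> R \<and> y \<in> R}"

lemma ideal2I: "x \<in> R \<Longrightarrow> y \<in> R \<Longrightarrow> z = x * p + y * q \<Longrightarrow> z \<in> ideal2 p q"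
  unfolding ideal2_def by blast

lemma ideal2_zero: "0 \<in> ideal2 p q"
  by (rule ideal2I[of 0 0]) (auto intro: in_intros)

lemma ideal2_add: "u \<in> ideal2 p q \<Longrightarrow> v \<in> ideal2 p q \<Longrightarrow> u + v \<in> ideal2 p q"
proof -
  assume "u \<in> ideal2 p q" "v \<in> ideal2 p q"
  then obtain x y x' y' where "x \<in> R" "y \<in> R" "u = x * p + y * q" "x' \<in> R" "y' \<in> R" "v = x' * p + y' * q"
    unfolding ideal2_def by auto
  then show ?thesis
    by (intro ideal2I[of "x + x'" "y + y'"]) (auto intro: in_intros simp: algebra_simps)
qed

lemma ideal2_mult: "r \<in> R \<Longrightarrow> u \<in> ideal2 p q \<Longrightarrow> r * u \<in> ideal2 p q"
proof -
  assume "u \<in> ideal2 p q" "r \<in> R"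
  then obtain x y where "x \<in> R" "y \<in> R" "u = x * p + y * q"
    unfolding ideal2_def by auto
  then show ?thesis
    using \<open>r \<in> R\<close> by (intro ideal2I[of "r * x" "r * y"]) (auto intro: in_intros simp: algebra_simps)
qed

lemma ideal2_mult': "r \<in> R \<Longrightarrow> u \<in> ideal2 p q \<Longrightarrow> u * r \<in> ideal2 p q"
  using ideal2_mult[of r u p q] by (simp add: mult.commute)

lemma ideal2_diff: "u \<in> ideal2 p q \<Longrightarrow> v \<in> ideal2 p q \<Longrightarrow> u - v \<in> ideal2 p q"
  using ideal2_add[of u p q "- 1 * v"] ideal2_mult[of "- 1" v p q] by (simp add: uminus_in one_in)

lemma ideal2_gen: "p \<in> ideal2 p q" "q \<in> ideal2 p q"
  by (rule ideal2I[of 1 0] ideal2I[of 0 1]; auto intro: in_intros)+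

lemma ideal2_sum: "(\<And>x. x \<in> A \<Longrightarrow> g x \<in> ideal2 p q) \<Longrightarrow> sum g A \<in> ideal2 p q"
  by (induction A rule: infinite_finite_induct) (auto intro: ideal2_zero ideal2_add)

lemma ideal2_subset:
  "p' \<in> ideal2 p q \<Longrightarrow> q' \<in> ideal2 p q \<Longrightarrow> z \<in> ideal2 p' q' \<Longrightarrow> z \<in> ideal2 p q"
  unfolding ideal2_def[of p' q'] by (auto intro!: ideal2_add ideal2_mult)

end

text \<open>Modulo \<open>f\<close> the maximal ideal is generated by \<open>t\<close>, and no power
  of \<open>t\<close> vanishes. Thus \<open>R/(f)\<close> can be handled like a discrete valuation
  ring with uniformizer \<open>t\<close>, the situation at a smooth point of the curve.\<close>

locale branch = local_algebra +
  fixes f t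
  assumes f_in_M: "f \<in> M" and t_in_M: "t \<in> M"
    and generators: "M \<subseteq> ideal2 t f"
    and t_not_nilpotent: "x \<in> R \<Longrightarrow> t ^ i \<noteq> f * x"
begin

lemmas ft_in = f_in_M[THEN M_in] t_in_M[THEN M_in]

text \<open>The truncated power series of \<open>h\<close> in the parameter \<open>t\<close> is
  found one coefficient at a time: the residue of the cofactor of \<open>t ^ n\<close> is the next
  coefficient, and what remains of the cofactor lies in \<open>M\<close>, so it yields another
  factor \<open>t\<close> modulo \<open>f\<close>.\<close>

lemma expansion:
  assumes "h \<in> R"
  shows "\<exists>c. h - (\<Sum>i<n. k (c i) * t ^ i) \<in> ideal2 (t ^ n) f"
proof (induction n)
  case 0
  show ?case using assms by (intro exI ideal2I[of h 0]) (auto intro: in_intros)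
next
  case (Suc n)
  then obtain c x y where *: "x \<in> R" "y \<in> R" "h - (\<Sum>i<n. k (c i) * t ^ i) = x * t ^ n + y * f"
    unfolding ideal2_def by blast
  obtain c' where "x - k c' \<in> M" using residue * by blast
  then obtain x' y' where **: "x' \<in> R" "y' \<in> R" "x = k c' + x' * t + y' * f"
    using generators unfolding ideal2_def by (force simp: algebra_simps)
  let ?c = "c(n := c')"
  have "(\<Sum>i<n. k (?c i) * t ^ i) = (\<Sum>i<n. k (c i) * t ^ i)"
    by (rule sum.cong) auto
  then have "h - (\<Sum>i<Suc n. k (?c i) * t ^ i) = x * t ^ n + y * f - k c' * t ^ n"
    using *(3) by (simp add: algebra_simps)
  also have "\<dots> = x' * t ^ Suc n + (y' * t ^ n + y) * f"
    unfolding **(3) by (simp add: algebra_simps)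
  finally show ?case
    using * ** ft_in by (intro exI[of _ ?c] ideal2I) (auto intro: in_intros)
qed

text \<open>This is the upper bound for the dimension of the quotient by \<open>q\<close> and
  \<open>f\<close>. Since \<open>u\<close> is a unit, \<open>t ^ n\<close> lies in that ideal, so
  every element reduces to a combination of the \<open>n\<close> powers of \<open>t\<close> below
  \<open>t ^ n\<close>, and more than \<open>n\<close> elements are dependent.\<close>

lemma linear_relation_mod:
  assumes q: "q - t ^ n * u \<in> ideal2 0 f" and u: "u \<in> R" "u \<notin> M"
    and S: "finite S" "S \<subseteq> R" "n < card S"
  shows "\<exists>c. (\<exists>s\<in>S. c s \<noteq> 0) \<and> (\<Sum>s\<in>S. k (c s) * s) \<in> ideal2 q f"
proof -
  have u0: "u \<noteq> 0" using u M_mult[OF t_in_M zero_in] by auto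
  obtain r where r: "r \<in> R" "q = t ^ n * u + r * f"
    using q unfolding ideal2_def by (auto simp: algebra_simps)
  have "t ^ n = inverse u * q + (- inverse u * r) * f"
    using u0 by (simp add: r(2) algebra_simps)
  then have tn: "t ^ n \<in> ideal2 q f"
    using u r inverse_in by (intro ideal2I[of "inverse u" "- inverse u * r"]) (auto intro: in_intros)
  have "\<forall>s\<in>S. \<exists>c. s - (\<Sum>i<n. k (c i) * t ^ i) \<in> ideal2 (t ^ n) f"
    using expansion S by blast
  then obtain v where v: "\<And>s. s \<in> S \<Longrightarrow> s - (\<Sum>i<n. k (v s i) * t ^ i) \<in> ideal2 (t ^ n) f"
    by metis
  obtain c where c: "\<exists>s\<in>S. c s \<noteq> 0" "\<And>i. i < n \<Longrightarrow> (\<Sum>s\<in>S. c s * v s i) = 0"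
    using nontrivial_linear_relation[OF S(1,3), of v] by blast
  have "(\<Sum>s\<in>S. k (c s) * (\<Sum>i<n. k (v s i) * t ^ i)) = (\<Sum>i<n. k (\<Sum>s\<in>S. c s * v s i) * t ^ i)"
    by (simp add: sum_distrib_left sum_distrib_right k_sum k_mult mult.assoc
        sum.swap[of _ S "{..<n}"])
  also have "\<dots> = 0" using c by (simp add: k_0)
  finally have "(\<Sum>s\<in>S. k (c s) * s) = (\<Sum>s\<in>S. k (c s) * (s - (\<Sum>i<n. k (v s i) * t ^ i)))"
    by (simp add: right_diff_distrib sum_subtractf)
  also have "\<dots> \<in> ideal2 q f"
    using ideal2_subset[OF tn ideal2_gen(2)] v by (intro ideal2_sum ideal2_mult in_intros) blast
  finally show ?thesis using c by blast
qed

text \<open>At the first nonzero coefficient \<open>c i\<close> the relation reads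
  \<open>t ^ i\<close> times a unit equals a multiple of \<open>f\<close>, which contradicts
  \<open>t_not_nilpotent\<close>.\<close>

lemma powers_independent:
  assumes "(\<Sum>i<n. k (c i) * t ^ i) \<in> ideal2 (t ^ n) f" "i < n"
  shows "c i = 0"
  using assms(2)
proof (induction i rule: less_induct)
  case (less i)
  show ?case
  proof (rule ccontr)
    assume "c i \<noteq> 0"
    obtain x y where xy: "x \<in> R" "y \<in> R" "(\<Sum>i<n. k (c i) * t ^ i) = x * t ^ n + y * f"
      using assms(1) unfolding ideal2_def by blast
    \<comment> \<open>Here \<open>m\<close> counts the terms after index \<open>i\<close>; the sum
      is split into the part below \<open>i\<close>, which vanishes by induction, and the part from
      \<open>i\<close> on.\<close>
    obtain m where n: "n = Suc (i + m)" using less.prems less_imp_Suc_add by blast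
    have "(\<Sum>i<n. k (c i) * t ^ i) = (\<Sum>i'<i. k (c i') * t ^ i') + (\<Sum>j<Suc m. k (c (i + j)) * t ^ (i + j))"
    proof -
      have "(\<Sum>j\<in>{..<i + Suc m}. k (c j) * t ^ j)
          = (\<Sum>j\<in>{..<i}. k (c j) * t ^ j) + (\<Sum>j\<in>{i..<i + Suc m}. k (c j) * t ^ j)"
        by (metis (no_types, lifting) lessThan_atLeast0 sum.atLeastLessThan_concat le0 le_add1)
      then show ?thesis
        using sum.shift_bounds_nat_ivl[of "\<lambda>j. k (c j) * t ^ j" 0 i "Suc m"]
        by (simp add: n lessThan_atLeast0 add.commute)
    qed
    also have "(\<Sum>i'<i. k (c i') * t ^ i') = 0"
      using less by (intro sum.neutral) (auto simp: k_0)
    also have "(\<Sum>j<Suc m. k (c (i + j)) * t ^ (i + j))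
        = t ^ i * (k (c i) + t * (\<Sum>j<m. k (c (i + Suc j)) * t ^ j))"
      by (simp only: sum.lessThan_Suc_shift) (simp add: power_add sum_distrib_left algebra_simps)
    finally have "t ^ i * (k (c i) + t * ((\<Sum>j<m. k (c (i + Suc j)) * t ^ j) - x * t ^ m)) = f * y"
      using xy(3) by (simp add: n power_add algebra_simps)
    \<comment> \<open>The cofactor \<open>w\<close> has residue \<open>c i\<close>, which is
      nonzero, so it can be inverted in \<open>R\<close>.\<close>
    moreover define w where "w = k (c i) + t * ((\<Sum>j<m. k (c (i + Suc j)) * t ^ j) - x * t ^ m)"
    ultimately have eq: "t ^ i * w = f * y" by simp
    have "(\<Sum>j<m. k (c (i + Suc j)) * t ^ j) - x * t ^ m \<in> R"
      using xy ft_in by (auto intro!: in_intros)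
    then have "t * ((\<Sum>j<m. k (c (i + Suc j)) * t ^ j) - x * t ^ m) \<in> M"
      using t_in_M by (rule M_mult[rotated])
    then have w: "w \<in> R" "w \<notin> M"
      using \<open>c i \<noteq> 0\<close> unfolding w_def by (simp_all add: k_in add_in M_in unit_add_M k_unit)
    moreover have "w \<noteq> 0" using w M_mult[OF t_in_M zero_in] by auto
    ultimately have "t ^ i = f * (y * inverse w)"
      using eq by (simp add: field_simps)
    with t_not_nilpotent[of "y * inverse w" i] w xy show False
      by (auto intro: in_intros inverse_in)
  qed
qed

text \<open>Independence is defined for sets instead of families, so a lower bound on the
  multiplicity requires the powers of \<open>t\<close> to be pairwise distinct.\<close>

lemma inj_powers: "inj_on (\<lambda>i. t ^ i) UNIV"
proof (rule linorder_inj_onI')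
  fix i j :: nat assume "i < j"
  show "t ^ i \<noteq> t ^ j"
  proof
    assume *: "t ^ i = t ^ j"
    have "(\<Sum>l<j. k (if l = i then 1 else 0) * t ^ l) = t ^ i"
      using \<open>i < j\<close> by (simp add: k_0 k_1 if_distrib[of k] if_distrib[of "\<lambda>x. x * _"] cong: if_cong)
    then have "(\<Sum>l<j. k (if l = i then 1 else 0) * t ^ l) \<in> ideal2 (t ^ j) f"
      using * ideal2_gen by simp
    from powers_independent[OF this \<open>i < j\<close>] show False by simp
  qed
qed

end

section \<open>Taylor expansion and congruences in the local ring\<close>

context local_algebra begin

lemma taylor:
  assumes "w \<in> R"
  shows "\<exists>s\<in>R. (1 + w) ^ d = (\<Sum>i<n. of_nat (d choose i) * w ^ i) + w ^ n * s"
proof -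
  let ?g = "\<lambda>i. of_nat (d choose i) * w ^ i"
  have "(1 + w) ^ d = (\<Sum>i\<le>d. ?g i)"
    using binomial_ring[of w 1 d] by (simp add: add.commute)
  \<comment> \<open>Padding with zero binomial coefficients lets the sum be cut at \<open>n\<close>
    whether or not \<open>n\<close> exceeds \<open>d\<close>.\<close>
  also have "\<dots> = (\<Sum>i\<in>{0..<n + Suc d}. ?g i)"
    by (rule sum.mono_neutral_left) (auto simp: binomial_eq_0)
  also have "\<dots> = (\<Sum>i\<in>{0..<n}. ?g i) + (\<Sum>i\<in>{n..<n + Suc d}. ?g i)"
    by (rule sum.atLeastLessThan_concat[symmetric]) auto
  also have "(\<Sum>i\<in>{n..<n + Suc d}. ?g i) = w ^ n * (\<Sum>i\<in>{0..<Suc d}. of_nat (d choose (i + n)) * w ^ i)"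
    using sum.shift_bounds_nat_ivl[of ?g 0 n "Suc d"]
    unfolding sum_distrib_left by (simp only: power_add mult_ac add_0_left add.commute[of n])
  finally show ?thesis
    using assms
    by (intro bexI[of _ "\<Sum>i\<in>{0..<Suc d}. of_nat (d choose (i + n)) * w ^ i"])
      (auto simp: lessThan_atLeast0 intro!: in_intros)
qed

lemma cong_mult:
  assumes "x - y \<in> ideal2 p q" "x' - y' \<in> ideal2 p q" "x \<in> R" "y' \<in> R"
  shows "x * x' - y * y' \<in> ideal2 p q"
proof -
  have "x * x' - y * y' = x * (x' - y') + y' * (x - y)" by (simp add: algebra_simps)
  then show ?thesis using assms by (simp add: ideal2_add ideal2_mult)
qed

lemma cong_power:
  assumes "x - y \<in> ideal2 p q" "x \<in> R" "y \<in> R"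
  shows "x ^ n - y ^ n \<in> ideal2 p q"
  by (induction n) (auto intro: cong_mult assms ideal2_zero in_intros)

lemma ideal2_cong:
  assumes "x - y \<in> ideal2 0 f" "y \<in> ideal2 p f"
  shows "x \<in> ideal2 p f"
proof -
  have "x - y \<in> ideal2 p f"
    using ideal2_subset[OF ideal2_zero ideal2_gen(2) assms(1)] .
  from ideal2_add[OF this assms(2)] show ?thesis by simp
qed

end

section \<open>The expansion of the Fermat equation\<close>

text \<open>The formulas are free of division, so they pass from the reals through the integers to
  every commutative ring.\<close>

lemma binomial_small:
  fixes d :: nat
  defines "D \<equiv> of_nat d :: 'a::comm_ring_1"
  shows "2 * of_nat (d choose 2) = D * (D - 1)"
    and "6 * of_nat (d choose 3) = D * (D - 1) * (D - 2)"
    and "24 * of_nat (d choose 4) = D * (D - 1) * (D - 2) * (D - 3)"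
proof -
  let ?r = "real d"
  have "2 * real (d choose 2) = ?r * (?r - 1)"
    "6 * real (d choose 3) = ?r * (?r - 1) * (?r - 2)"
    "24 * real (d choose 4) = ?r * (?r - 1) * (?r - 2) * (?r - 3)"
    by (simp_all add: binomial_gbinomial gbinomial_prod_rev eval_nat_numeral)
  then have "2 * int (d choose 2) = int d * (int d - 1)"
    "6 * int (d choose 3) = int d * (int d - 1) * (int d - 2)"
    "24 * int (d choose 4) = int d * (int d - 1) * (int d - 2) * (int d - 3)"
    by (simp_all flip: of_int_eq_iff[where 'a = real])
  from this[THEN arg_cong[of _ _ "of_int :: int \<Rightarrow> 'a"]]
  show "2 * of_nat (d choose 2) = D * (D - 1)"
    "6 * of_nat (d choose 3) = D * (D - 1) * (D - 2)"
    "24 * of_nat (d choose 4) = D * (D - 1) * (D - 2) * (D - 3)"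
    by (simp_all add: D_def)
qed

text \<open>Non-nilpotency is required of some \<open>h\<close> in \<open>M\<close> instead of
  \<open>b\<close> itself: \<open>h\<close> can then be a simple linear form, for which the
  condition is checked by divisibility of polynomials.\<close>

locale fermat_branch = local_algebra +
  fixes a b :: 'a and d :: nat
  assumes d: "3 \<le> d"
    and a_in_M: "a \<in> M" and b_in_M: "b \<in> M" and ab_generate: "M \<subseteq> ideal2 a b"
    and not_nilpotent:
      "\<exists>h\<in>M. \<forall>i. \<forall>x\<in>R. h ^ i \<noteq> ((1 + a + b) ^ d + (1 + a - b) ^ d - 2) * x"
begin

definition f where "f = (1 + a + b) ^ d + (1 + a - b) ^ d - 2"

abbreviation D where "D \<equiv> of_nat d :: 'a"

text \<open>The inhomogeneous equation of the conic, divided by 4.\<close>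

definition osc where
  "osc = 3 * (D - 1)\<^sup>2 * b\<^sup>2 + 6 * (D - 1) * a - (2 * D - 1) * (D - 3) * a\<^sup>2"

lemma ab_in: "a \<in> R" "b \<in> R"
  using a_in_M b_in_M M_in by auto

text \<open>To lowest order \<open>f\<close> is \<open>2 * D * a + D * (D - 1) * b\<^sup>2\<close>.
  Exactly, \<open>f = a * P + b\<^sup>2 * N\<close> with units \<open>P\<close> and
  \<open>N\<close>, and solving for \<open>a\<close> gives the unit \<open>- N / P\<close>.\<close>

lemma a_cong: "\<exists>e\<in>R. e \<notin> M \<and> a - b\<^sup>2 * e \<in> ideal2 0 f"
proof -
  obtain s where s: "s \<in> R" "(1 + (a + b)) ^ d = (\<Sum>i<3. of_nat (d choose i) * (a + b) ^ i) + (a + b) ^ 3 * s"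
    using taylor[of "a + b" d 3] ab_in add_in by blast
  obtain s' where s': "s' \<in> R" "(1 + (a - b)) ^ d = (\<Sum>i<3. of_nat (d choose i) * (a - b) ^ i) + (a - b) ^ 3 * s'"
    using taylor[of "a - b" d 3] ab_in diff_in by blast
  define C where "C = (of_nat (d choose 2) :: 'a)"
  \<comment> \<open>\<open>P\<close> collects the terms of \<open>f\<close> divisible by
    \<open>a\<close>, and \<open>N\<close> the cofactor of \<open>b\<^sup>2\<close> in the others.
    The nesting shows that \<open>P\<close> and \<open>N\<close> differ from \<open>2 * D\<close>
    and \<open>2 * C\<close> by elements of \<open>M\<close>.\<close>
  define P where "P = 2 * D + (a * (2 * C) + (a * (a * s) + (b * (3 * (a + b) * s)
    + (a * (a * s') + b * (3 * (b - a) * s')))))"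
  define N where "N = 2 * C + b * (s - s')"
  have f: "f = a * P + b\<^sup>2 * N"
    using s(2) s'(2) unfolding f_def add.assoc add_diff_eq[symmetric]
    by (simp add: P_def N_def C_def eval_nat_numeral algebra_simps)
  have C: "C \<in> R" by (simp add: C_def of_nat_in)
  have unit: "of_nat n \<notin> M" if "n \<noteq> 0" for n
    using k_in_M[of "of_nat n"] that by (auto simp: k_of_nat)
  have "2 * D \<notin> M" "2 * C \<notin> M"
    using unit[of "2 * d"] unit[of "2 * (d choose 2)"] d by (simp_all add: C_def)
  moreover have "P - 2 * D \<in> M" "N - 2 * C \<in> M"
    unfolding P_def N_def add_diff_cancel_left' using a_in_M b_in_M ab_in C s s'
    by (auto intro!: M_add M_mult in_intros)
  ultimately have "P \<notin> M" "N \<notin> M"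
    using unit_add_M[of "2 * D" "P - 2 * D"] unit_add_M[of "2 * C" "N - 2 * C"] C
    by (auto intro: in_intros)
  have PN: "P \<in> R" "N \<in> R"
    unfolding P_def N_def using ab_in C s s' by (auto intro!: in_intros)
  have "P \<noteq> 0" using \<open>P \<notin> M\<close> M_mult[OF a_in_M zero_in] by auto
  define e where "e = - (inverse P * N)"
  have "e \<in> R" using PN \<open>P \<notin> M\<close> by (auto simp: e_def intro!: in_intros inverse_in)
  moreover have "N = - (P * e)" using \<open>P \<noteq> 0\<close> by (simp add: e_def)
  then have "e \<notin> M" using \<open>N \<notin> M\<close> PN M_mult' M_uminus by auto
  moreover have "a - b\<^sup>2 * e = inverse P * f"
    using \<open>P \<noteq> 0\<close> by (simp add: e_def f field_simps)
  then have "a - b\<^sup>2 * e \<in> ideal2 0 f"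
    using PN \<open>P \<notin> M\<close> ideal2_mult[OF inverse_in ideal2_gen(2)] by simp
  ultimately show ?thesis by blast
qed

lemma f_in_M: "f \<in> M"
proof -
  obtain s where s: "s \<in> R" "(1 + (a + b)) ^ d = (\<Sum>i<1. of_nat (d choose i) * (a + b) ^ i) + (a + b) ^ 1 * s"
    using taylor[of "a + b" d 1] ab_in add_in by blast
  obtain s' where s': "s' \<in> R" "(1 + (a - b)) ^ d = (\<Sum>i<1. of_nat (d choose i) * (a - b) ^ i) + (a - b) ^ 1 * s'"
    using taylor[of "a - b" d 1] ab_in diff_in by blast
  have "f = (a + b) * s + (a - b) * s'"
    using s(2) s'(2) unfolding f_def add.assoc add_diff_eq[symmetric] by simp
  then show ?thesis
    using s s' a_in_M b_in_M by (auto intro!: M_add M_diff M_mult)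
qed

text \<open>Give \<open>a\<close> weight 2 and \<open>b\<close> weight 1. By \<open>a_cong\<close>
  every monomial of weight at least 6 lies in \<open>?K\<close>; dropping these from
  \<open>f\<close> leaves \<open>2 * T\<close>. The products \<open>a * T\<close> and
  \<open>b\<^sup>2 * T\<close> yield two relations of pure weight 4, which serve to remove the terms
  \<open>a * b\<^sup>2\<close> and \<open>b ^ 4\<close> from a multiple of \<open>T\<close>.\<close>

lemma osc_in_ideal: "osc \<in> ideal2 (b ^ 6) f"
proof -
  let ?K = "ideal2 (b ^ 6) f"
  obtain e where e: "e \<in> R" "a - b\<^sup>2 * e \<in> ideal2 0 f"
    using a_cong by blast
  note in_K = ideal2_mult ideal2_mult' ideal2_add ideal2_diff
  have a_pow: "a ^ i - (b\<^sup>2 * e) ^ i \<in> ideal2 0 f" for i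
    by (rule cong_power) (use e ab_in in \<open>auto intro: in_intros\<close>)
  have K1: "a ^ 3 \<in> ?K"
    using a_pow[of 3] by (rule ideal2_cong)
      (auto simp: power_mult_distrib simp flip: power_mult intro!: in_K ideal2_gen in_intros e)
  have "a ^ i * b ^ j - (b\<^sup>2 * e) ^ i * b ^ j \<in> ideal2 0 f" for i j
    using ideal2_mult'[OF power_in[OF ab_in(2), of j] a_pow[of i]] by (simp add: left_diff_distrib)
  note a_b_pow = this
  have K2: "a ^ 2 * b ^ 2 \<in> ?K"
  proof (rule ideal2_cong[OF a_b_pow])
    show "(b\<^sup>2 * e)\<^sup>2 * b\<^sup>2 \<in> ?K"
      using e by (intro ideal2I[of "e\<^sup>2" 0]) (simp_all add: zero_in mult_in eval_nat_numeral)
  qed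
  have K3: "a * b ^ 4 \<in> ?K"
  proof (rule ideal2_cong)
    show "a * b ^ 4 - (b\<^sup>2 * e) * b ^ 4 \<in> ideal2 0 f"
      using a_b_pow[of 1 4] by simp
    show "(b\<^sup>2 * e) * b ^ 4 \<in> ?K"
      using e by (intro ideal2I[of e 0]) (simp_all add: zero_in eval_nat_numeral)
  qed
  \<comment> \<open>The Taylor remainders are multiples of \<open>(a + b) ^ 6\<close> and
    \<open>(a - b) ^ 6\<close>. Modulo \<open>f\<close> their bases are divisible by
    \<open>b\<close>, so the sixth powers are divisible by \<open>b ^ 6\<close>.\<close>
  have w6: "(a + c * b) ^ 6 \<in> ?K" if "c \<in> R" for c
  proof (rule ideal2_cong)
    have "(a + c * b) - b * (b * e + c) \<in> ideal2 0 f"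
      using e(2) by (simp add: power2_eq_square algebra_simps)
    then show "(a + c * b) ^ 6 - (b * (b * e + c)) ^ 6 \<in> ideal2 0 f"
      by (rule cong_power) (use that e ab_in in \<open>auto intro!: in_intros\<close>)
    show "(b * (b * e + c)) ^ 6 \<in> ?K"
      unfolding power_mult_distrib using that e ab_in
      by (intro ideal2_mult' ideal2_gen) (auto intro!: in_intros)
  qed
  obtain s where s: "s \<in> R" "(1 + (a + b)) ^ d = (\<Sum>i<6. of_nat (d choose i) * (a + b) ^ i) + (a + b) ^ 6 * s"
    using taylor[of "a + b" d 6] ab_in add_in by blast
  obtain s' where s': "s' \<in> R" "(1 + (a - b)) ^ d = (\<Sum>i<6. of_nat (d choose i) * (a - b) ^ i) + (a - b) ^ 6 * s'"
    using taylor[of "a - b" d 6] ab_in diff_in by blast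
  define C where "C i = (of_nat (d choose i) :: 'a)" for i
  have C: "C i \<in> R" for i by (simp add: C_def of_nat_in)
  define T where "T = D * a + C 2 * (a\<^sup>2 + b\<^sup>2) + 3 * C 3 * (a * b\<^sup>2) + C 4 * b ^ 4"
  have f: "f = 2 * T + a ^ 3 * (2 * C 3 + 2 * C 4 * a + 2 * C 5 * a\<^sup>2 + 20 * C 5 * b\<^sup>2)
      + a ^ 2 * b ^ 2 * (12 * C 4) + a * b ^ 4 * (10 * C 5) + (a + 1 * b) ^ 6 * s + (a + (- 1) * b) ^ 6 * s'"
  proof -
    have *: "(\<Sum>i<6. of_nat (d choose i) * w ^ i)
        = 1 + D * w + C 2 * w ^ 2 + C 3 * w ^ 3 + C 4 * w ^ 4 + C 5 * w ^ 5" for w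
      by (simp add: C_def eval_nat_numeral)
    have "f = (\<Sum>i<6. of_nat (d choose i) * (a + b) ^ i) + (\<Sum>i<6. of_nat (d choose i) * (a - b) ^ i)
        - 2 + (a + 1 * b) ^ 6 * s + (a + (- 1) * b) ^ 6 * s'"
      using s(2) s'(2) unfolding f_def add.assoc add_diff_eq[symmetric] by simp
    then show ?thesis
      unfolding * T_def by (simp add: eval_nat_numeral algebra_simps)
  qed
  have T2: "2 * T \<in> ?K"
  proof -
    have "2 * T = f - (a ^ 3 * (2 * C 3 + 2 * C 4 * a + 2 * C 5 * a\<^sup>2 + 20 * C 5 * b\<^sup>2)
      + a ^ 2 * b ^ 2 * (12 * C 4) + a * b ^ 4 * (10 * C 5) + (a + 1 * b) ^ 6 * s + (a + (- 1) * b) ^ 6 * s')"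
      using f by (simp add: algebra_simps)
    also have "\<dots> \<in> ?K"
      by (intro ideal2_diff ideal2_add ideal2_mult' ideal2_gen K1 K2 K3 w6 in_intros C ab_in s s')
    finally show ?thesis .
  qed
  have two: "k (1 / 2) * (2 * x) = x" for x
  proof -
    have "k (1 / 2) * 2 = 1" using k_mult[of "1 / 2" 2] by (simp add: k_numeral k_1)
    then show ?thesis by (simp flip: mult.assoc)
  qed
  have T: "T \<in> ?K"
    using ideal2_mult[OF k_in[of "1 / 2"] T2] by (simp only: two)
  have E1: "D * a\<^sup>2 + C 2 * (a * b\<^sup>2) \<in> ?K"
  proof -
    have "D * a\<^sup>2 + C 2 * (a * b\<^sup>2) = a * T - (a ^ 3 * C 2 + a ^ 2 * b ^ 2 * (3 * C 3) + a * b ^ 4 * C 4)"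
      by (simp add: T_def eval_nat_numeral algebra_simps)
    also have "\<dots> \<in> ?K"
      by (intro ideal2_diff ideal2_add ideal2_mult' ideal2_mult[OF _ T] K1 K2 K3 in_intros C ab_in)
    finally show ?thesis .
  qed
  have E2: "D * (a * b\<^sup>2) + C 2 * b ^ 4 \<in> ?K"
  proof -
    have "D * (a * b\<^sup>2) + C 2 * b ^ 4 = b\<^sup>2 * T - (a ^ 2 * b ^ 2 * C 2 + a * b ^ 4 * (3 * C 3) + b ^ 6 * C 4)"
      by (simp add: T_def eval_nat_numeral algebra_simps)
    also have "\<dots> \<in> ?K"
      by (intro ideal2_diff ideal2_add ideal2_mult' ideal2_mult[OF _ T] K2 K3 in_intros C ab_in ideal2_gen)
    finally show ?thesis .
  qed
  \<comment> \<open>\<open>A\<close> and \<open>B\<close> are chosen to cancel the coefficients of \<open>a\<^sup>2\<close> and \<open>ab\<^sup>2\<close> below; that of \<open>b\<^sup>4\<close> then vanishes as well.\<close>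
  define A where "A = - (2 * D - 1) * (D - 3) - 3 * (D - 1)\<^sup>2"
  define B where "B = - 6 * (D - 1)\<^sup>2 * (D - 2) - A * (D - 1)"
  note C_simps = binomial_small[of d, where 'a = 'a, folded C_def]
  \<comment> \<open>The factors 24, 4 and 2 make the binomial coefficients appear in the multiples
    \<open>2 * C 2\<close>, \<open>6 * C 3\<close> and \<open>24 * C 4\<close>, which
    \<open>binomial_small\<close> turns into polynomials in \<open>D\<close>.\<close>
  have "4 * D * osc = 24 * (D - 1) * T + 4 * A * (D * a\<^sup>2 + C 2 * (a * b\<^sup>2))
      + 2 * B * (D * (a * b\<^sup>2) + C 2 * b ^ 4)"
  proof -
    have "24 * (D - 1) * T + 4 * A * (D * a\<^sup>2 + C 2 * (a * b\<^sup>2)) + 2 * B * (D * (a * b\<^sup>2) + C 2 * b ^ 4)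
      = 24 * (D - 1) * D * a + 12 * (D - 1) * (2 * C 2) * (a\<^sup>2 + b\<^sup>2) + 12 * (D - 1) * (6 * C 3) * (a * b\<^sup>2)
        + (D - 1) * (24 * C 4) * b ^ 4 + 4 * A * D * a\<^sup>2 + 2 * A * (2 * C 2) * (a * b\<^sup>2)
        + 2 * B * D * (a * b\<^sup>2) + B * (2 * C 2) * b ^ 4"
      by (simp add: T_def algebra_simps)
    also have "\<dots> = 4 * D * osc"
      unfolding C_simps A_def B_def osc_def by (simp add: eval_nat_numeral algebra_simps)
    finally show ?thesis by simp
  qed
  also have "\<dots> \<in> ?K"
    unfolding A_def B_def
    by (intro ideal2_add ideal2_mult[OF _ T] ideal2_mult[OF _ E1] ideal2_mult[OF _ E2] in_intros)
  finally have "4 * D * osc \<in> ?K" .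
  then have "k (1 / (4 * of_nat d)) * (4 * D * osc) \<in> ?K"
    by (rule ideal2_mult[OF k_in])
  moreover have "k (1 / (4 * of_nat d)) * (4 * D) = 1"
    using d k_mult[of "1 / (4 * of_nat d)" "4 * of_nat d"] by (simp add: k_mult k_numeral k_of_nat k_1)
  ultimately show ?thesis by (simp flip: mult.assoc)
qed

text \<open>By \<open>a_cong\<close>, \<open>b\<close> alone generates \<open>M\<close> modulo
  \<open>f\<close>. Writing \<open>h = r * b + s * f\<close> shows \<open>h ^ i\<close> congruent to
  \<open>r ^ i * b ^ i\<close>, so a power of \<open>b\<close> divisible by \<open>f\<close> would
  contradict \<open>not_nilpotent\<close>.\<close>

sublocale branch R M k f b
proof
  obtain e where e: "e \<in> R" "a - b\<^sup>2 * e \<in> ideal2 0 f"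
    using a_cong by blast
  have "a \<in> ideal2 b f"
    using e(2) by (rule ideal2_cong)
      (use e ab_in in \<open>auto intro!: ideal2_mult ideal2_mult' ideal2_gen simp: power2_eq_square\<close>)
  then show gen: "M \<subseteq> ideal2 b f"
    using ideal2_subset ideal2_gen(1) ab_generate by blast
  fix i x assume x: "x \<in> R"
  show "b ^ i \<noteq> f * x"
  proof
    assume *: "b ^ i = f * x"
    obtain h where h: "h \<in> M" "\<And>i x. x \<in> R \<Longrightarrow> h ^ i \<noteq> f * x"
      using not_nilpotent by (auto simp: f_def)
    obtain r s where rs: "r \<in> R" "s \<in> R" "h = r * b + s * f"
      using h(1) gen unfolding ideal2_def by blast
    have "h - r * b \<in> ideal2 0 f"
      using rs by (intro ideal2I[of 0 s]) (auto intro: in_intros)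
    then have "h ^ i - (r * b) ^ i \<in> ideal2 0 f"
      by (rule cong_power) (use rs ab_in h M_in in \<open>auto intro: in_intros\<close>)
    then obtain y where y: "y \<in> R" "h ^ i - (r * b) ^ i = y * f"
      unfolding ideal2_def by auto
    then have "h ^ i = f * (r ^ i * x + y)"
      by (simp add: power_mult_distrib * algebra_simps)
    moreover have "r ^ i * x + y \<in> R"
      using rs y x by (intro in_intros)
    ultimately show False using h(2) by blast
  qed
qed (fact f_in_M b_in_M)+

text \<open>The first nonzero one among \<open>r0\<close>, \<open>r1\<close>, \<open>r2\<close>,
  \<open>r3\<close>, \<open>r4\<close> fixes the order \<open>n\<close>: all later terms have larger
  order, and \<open>osc\<close> only contributes order 6 or more.\<close>

lemma conic_order:
  assumes q: "q = k c * osc + (k r0 + k r1 * b + k r2 * a + k r3 * (a * b) + k r4 * a\<^sup>2)"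
    and nz: "r0 \<noteq> 0 \<or> r1 \<noteq> 0 \<or> r2 \<noteq> 0 \<or> r3 \<noteq> 0 \<or> r4 \<noteq> 0"
  shows "\<exists>n\<le>4. \<exists>u\<in>R. u \<notin> M \<and> q - b ^ n * u \<in> ideal2 0 f"
proof -
  obtain e where e: "e \<in> R" "e \<notin> M" "a - b\<^sup>2 * e \<in> ideal2 0 f"
    using a_cong by blast
  obtain y z where yz: "y \<in> R" "z \<in> R" "osc = y * b ^ 6 + z * f"
    using osc_in_ideal unfolding ideal2_def by blast
  \<comment> \<open>\<open>p\<close> arises from \<open>q\<close> by replacing \<open>a\<close> with
    \<open>b\<^sup>2 * e\<close> and \<open>osc\<close> with its multiple of \<open>b ^ 6\<close>,
    which changes nothing modulo \<open>f\<close>.\<close>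
  define p where "p = k r0 + k r1 * b + k r2 * (b\<^sup>2 * e) + k r3 * (b ^ 3 * e) + k r4 * (b ^ 4 * e\<^sup>2)
    + k c * y * b ^ 6"
  have "a\<^sup>2 - (b\<^sup>2 * e)\<^sup>2 \<in> ideal2 0 f"
    using e ab_in by (intro cong_power) (auto intro: in_intros)
  moreover have "q - p = k c * z * f + k r2 * (a - b\<^sup>2 * e) + k r3 * b * (a - b\<^sup>2 * e) + k r4 * (a\<^sup>2 - (b\<^sup>2 * e)\<^sup>2)"
    by (simp add: q p_def yz(3) eval_nat_numeral algebra_simps)
  ultimately have qp: "q - p \<in> ideal2 0 f"
    using e yz ab_in by (auto intro!: ideal2_add ideal2_mult in_intros ideal2_gen)
  have unit: "k r * x + b * v \<in> R \<and> k r * x + b * v \<notin> M" if "r \<noteq> 0" "x \<in> R" "x \<notin> M" "v \<in> R" for r x v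
  proof
    show "k r * x + b * v \<in> R" using that ab_in by (intro in_intros)
    show "k r * x + b * v \<notin> M"
      using that b_in_M by (intro unit_add_M unit_mult k_unit M_mult in_intros)
  qed
  have 1: "1 \<in> R" "1 \<notin> M" "e\<^sup>2 \<in> R" "e\<^sup>2 \<notin> M"
    using k_in_M[of 1] e by (auto simp: one_in k_1 power2_eq_square mult_in unit_mult)
  note in' = in_intros ab_in e yz
  consider "r0 \<noteq> 0" | "r0 = 0" "r1 \<noteq> 0" | "r0 = 0" "r1 = 0" "r2 \<noteq> 0"
    | "r0 = 0" "r1 = 0" "r2 = 0" "r3 \<noteq> 0" | "r0 = 0" "r1 = 0" "r2 = 0" "r3 = 0" "r4 \<noteq> 0"
    using nz by blast
  then have "\<exists>n\<le>4. \<exists>u\<in>R. u \<notin> M \<and> p = b ^ n * u"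
  proof cases
    case 1
    then show ?thesis
      using unit[OF 1 \<open>1 \<in> R\<close> \<open>1 \<notin> M\<close>, of "k r1 + k r2 * (b * e) + k r3 * (b ^ 2 * e) + k r4 * (b ^ 3 * e\<^sup>2) + k c * y * b ^ 5"]
      by (intro exI[of _ 0] conjI bexI) (auto intro!: in' simp: p_def eval_nat_numeral algebra_simps)
  next
    case 2
    then show ?thesis
      using unit[OF 2(2) \<open>1 \<in> R\<close> \<open>1 \<notin> M\<close>, of "k r2 * e + k r3 * (b * e) + k r4 * (b ^ 2 * e\<^sup>2) + k c * y * b ^ 4"]
      by (intro exI[of _ 1] conjI bexI) (auto intro!: in' simp: p_def k_0 eval_nat_numeral algebra_simps)
  next
    case 3
    then show ?thesis
      using unit[OF 3(3) e(1,2), of "k r3 * e + k r4 * (b * e\<^sup>2) + k c * y * b ^ 3"]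
      by (intro exI[of _ 2] conjI bexI) (auto intro!: in' simp: p_def k_0 eval_nat_numeral algebra_simps)
  next
    case 4
    then show ?thesis
      using unit[OF 4(4) e(1,2), of "k r4 * e\<^sup>2 + k c * y * b ^ 2"]
      by (intro exI[of _ 3] conjI bexI) (auto intro!: in' simp: p_def k_0 eval_nat_numeral algebra_simps)
  next
    case 5
    then show ?thesis
      using unit[OF 5(5) \<open>e\<^sup>2 \<in> R\<close> \<open>e\<^sup>2 \<notin> M\<close>, of "k c * y * b"]
      by (intro exI[of _ 4] conjI bexI) (auto intro!: in' simp: p_def k_0 eval_nat_numeral algebra_simps)
  qed
  with qp show ?thesis by blast
qed

end

section \<open>The local ring of the plane at a point\<close>

definition const_fract :: "complex \<Rightarrow> poly3 fract" where
  "const_fract c = to_fract (const3 c)"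

lemma to_fract_power: "to_fract (x ^ n) = to_fract x ^ n"
  by (induction n) simp_all

lemma eval3_nonzero: "eval3 F v \<noteq> 0 \<Longrightarrow> F \<noteq> 0"
  by auto

text \<open>A nonzero last coordinate puts the point in the chart where \<open>Z3\<close> is
  invertible, so powers of \<open>Z3\<close> are admissible denominators there.\<close>

locale affine_point =
  fixes \<alpha> \<gamma> :: complex
  assumes \<gamma>: "\<gamma> \<noteq> 0"
begin

abbreviation p where "p \<equiv> hpoint \<alpha> 1 \<gamma>"
definition v :: "complex ^ 3" where "v = vector [\<alpha>, 1, \<gamma>]"

lemma v_nth [simp]: "v $ 1 = \<alpha>" "v $ 2 = 1" "v $ 3 = \<gamma>"
  by (simp_all add: v_def)

lemma vanishes_at_p: "homogeneous n F \<Longrightarrow> vanishes_at F p \<longleftrightarrow> eval3 F v = 0"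
  by (simp add: vanishes_at_hpoint_iff v_def)

lemma local_ring_p:
  "local_ring p = {to_fract A / to_fract B | A B n.
     homogeneous n A \<and> homogeneous n B \<and> eval3 B v \<noteq> 0}"
  unfolding local_ring_def using vanishes_at_p by blast

lemma local_ringI:
  "homogeneous n A \<Longrightarrow> homogeneous n B \<Longrightarrow> eval3 B v \<noteq> 0 \<Longrightarrow> to_fract A / to_fract B \<in> local_ring p"
  unfolding local_ring_p by blast

definition M where
  "M = {to_fract A / to_fract B | A B n.
     homogeneous n A \<and> homogeneous n B \<and> eval3 B v \<noteq> 0 \<and> eval3 A v = 0}"

lemma MI:
  "homogeneous n A \<Longrightarrow> homogeneous n B \<Longrightarrow> eval3 B v \<noteq> 0 \<Longrightarrow> eval3 A v = 0 \<Longrightarrow>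
    to_fract A / to_fract B \<in> M"
  unfolding M_def by blast

lemma add_fractions:
  assumes "eval3 B v \<noteq> 0" "eval3 B' v \<noteq> 0"
  shows "to_fract A / to_fract B + to_fract A' / to_fract B'
    = to_fract (A * B' + A' * B) / to_fract (B * B')"
  using assms[THEN eval3_nonzero] by (simp add: add_frac_eq)

sublocale local_algebra "local_ring p" M const_fract
proof
  show "const_fract 1 = 1" "const_fract (c + c') = const_fract c + const_fract c'"
    "const_fract (c * c') = const_fract c * const_fract c'" for c c'
    by (simp_all add: const_fract_def const3_hom)
  show "const_fract c \<in> local_ring p" for c
    using local_ringI[of 0 "const3 c" "const3 1"] by (simp add: const_fract_def const3_hom)
  show "M \<subseteq> local_ring p"
    unfolding M_def local_ring_p by blast
  fix x y
  show "x + y \<in> local_ring p" "x * y \<in> local_ring p" if xy: "x \<in> local_ring p" "y \<in> local_ring p"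
  proof -
    obtain A B n A' B' n' where *: "homogeneous n A" "homogeneous n B" "eval3 B v \<noteq> 0"
      "homogeneous n' A'" "homogeneous n' B'" "eval3 B' v \<noteq> 0"
      "x = to_fract A / to_fract B" "y = to_fract A' / to_fract B'"
      using xy unfolding local_ring_p by blast
    have "homogeneous (n + n') (A * B' + A' * B)"
      using homogeneous_add homogeneous_mult[of n A n' B'] homogeneous_mult[of n' A' n B] *
      by (simp add: add.commute)
    then show "x + y \<in> local_ring p"
      using * unfolding *(7,8) add_fractions[OF *(3,6)]
      by (intro local_ringI[of "n + n'"]) (auto intro: homogeneous_mult)
    show "x * y \<in> local_ring p"
      using * local_ringI[of "n + n'" "A * A'" "B * B'"] by (simp add: homogeneous_mult)
  qed
  show "x + y \<in> M" if xy: "x \<in> M" "y \<in> M"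
  proof -
    obtain A B n A' B' n' where *: "homogeneous n A" "homogeneous n B" "eval3 B v \<noteq> 0"
      "homogeneous n' A'" "homogeneous n' B'" "eval3 B' v \<noteq> 0"
      "x = to_fract A / to_fract B" "y = to_fract A' / to_fract B'" "eval3 A v = 0" "eval3 A' v = 0"
      using xy unfolding M_def by blast
    have "homogeneous (n + n') (A * B' + A' * B)"
      using homogeneous_add homogeneous_mult[of n A n' B'] homogeneous_mult[of n' A' n B] *
      by (simp add: add.commute)
    then show "x + y \<in> M"
      using * unfolding *(7,8) add_fractions[OF *(3,6)]
      by (intro MI[of "n + n'"]) (auto intro: homogeneous_mult)
  qed
  show "x * y \<in> M" if xy: "x \<in> M" "y \<in> local_ring p"
  proof -
    obtain A B n A' B' n' where *: "homogeneous n A" "homogeneous n B" "eval3 B v \<noteq> 0"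
      "homogeneous n' A'" "homogeneous n' B'" "eval3 B' v \<noteq> 0"
      "x = to_fract A / to_fract B" "y = to_fract A' / to_fract B'" "eval3 A v = 0"
      using xy unfolding M_def local_ring_p by blast
    then show "x * y \<in> M"
      using MI[of "n + n'" "A * A'" "B * B'"] by (simp add: homogeneous_mult)
  qed
  show "c = 0" if cM: "const_fract c \<in> M" for c
  proof -
    obtain A B where *: "eval3 B v \<noteq> 0" "eval3 A v = 0" "const_fract c = to_fract A / to_fract B"
      using cM unfolding M_def by blast
    then have "to_fract (const3 c * B) = to_fract A"
      using eval3_nonzero by (simp add: const_fract_def eq_divide_eq)
    then have "eval3 (const3 c * B) v = eval3 A v"
      unfolding to_fract_eq_iff by simp
    with * show ?thesis by simp
  qed
  show "inverse x \<in> local_ring p" if x: "x \<in> local_ring p" "x \<notin> M"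
  proof -
    obtain A B n where *: "homogeneous n A" "homogeneous n B" "eval3 B v \<noteq> 0"
      "x = to_fract A / to_fract B"
      using x unfolding local_ring_p by blast
    then have "eval3 A v \<noteq> 0" using x MI by blast
    then show ?thesis using * local_ringI[of n B A] by simp
  qed
  show "\<exists>c. x - const_fract c \<in> M" if x: "x \<in> local_ring p"
  proof -
    obtain A B n where *: "homogeneous n A" "homogeneous n B" "eval3 B v \<noteq> 0"
      "x = to_fract A / to_fract B"
      using x unfolding local_ring_p by blast
    \<comment> \<open>The residue of a fraction is its value at the point; subtracting it makes the
      numerator vanish at \<open>v\<close>.\<close>
    let ?c = "eval3 A v / eval3 B v"
    have "x - const_fract ?c = to_fract (A - const3 ?c * B) / to_fract B"
      using eval3_nonzero[OF *(3)] by (simp add: *(4) const_fract_def diff_divide_distrib)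
    also have "\<dots> \<in> M"
      using * by (intro MI[of n]) (auto intro: homogeneous_diff homogeneous_const_mult)
    finally show ?thesis by blast
  qed
qed

text \<open>This is passage to the chart \<open>Z3 = 1\<close> inside the fraction field. The degree
  is an explicit argument, so sums and products can be treated without reading a degree off
  \<open>F\<close>.\<close>

definition dehom :: "nat \<Rightarrow> poly3 \<Rightarrow> poly3 fract" where
  "dehom n F = to_fract F / to_fract (Z3 ^ n)"

lemma Z3_nz: "to_fract Z3 \<noteq> 0" "to_fract Y3 \<noteq> 0"
  by (simp_all add: Z3_def Y3_def)

lemma dehom_simps: "dehom n 0 = 0" "dehom n (F + G) = dehom n F + dehom n G"
  "dehom n (F - G) = dehom n F - dehom n G"
  "dehom (m + n) (F * G) = dehom m F * dehom n G"
  "dehom n (const3 c * F) = const_fract c * dehom n F"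
  "dehom 1 Z3 = 1"
  using Z3_nz by (simp_all add: dehom_def add_divide_distrib diff_divide_distrib power_add const_fract_def)

lemma dehom_monom:
  assumes "i + j + k = n"
  shows "dehom n (const3 c * X3 ^ i * Y3 ^ j * Z3 ^ k)
    = const_fract c * (to_fract X3 / to_fract Z3) ^ i * (to_fract Y3 / to_fract Z3) ^ j"
  using Z3_nz assms[symmetric]
  by (simp add: dehom_def to_fract_power power_divide power_add const_fract_def field_simps)

lemma dehom_inj: "dehom n F = dehom n G \<Longrightarrow> F = G"
  using Z3_nz by (simp add: dehom_def to_fract_power)

text \<open>Every local equation of a nonzero form of degree \<open>m\<close> is its
  dehomogenization times a factor \<open>Z3 ^ m / B\<close> of the local ring, and
  \<open>B = Z3 ^ m\<close> is one choice. The ideal defined by all choices therefore has just two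
  generators.\<close>

lemma local_ideal_eq:
  assumes F: "homogeneous m F" "F \<noteq> 0" and G: "homogeneous n G" "G \<noteq> 0"
  shows "local_ideal F G p = ideal2 (dehom m F) (dehom n G)"
proof -
  have eqs: "local_equations F p = {dehom m F * r | r. \<exists>B. r = to_fract (Z3 ^ m) / to_fract B \<and>
      homogeneous m B \<and> eval3 B v \<noteq> 0}" (is "_ = ?R") if "homogeneous m F" "F \<noteq> 0" for m F
  proof -
    have "local_equations F p = {to_fract F / to_fract B | B. homogeneous m B \<and> eval3 B v \<noteq> 0}"
      unfolding local_equations_def using homogeneous_unique[OF that(1) _ that(2)] that(1) vanishes_at_p
      by blast
    also have "to_fract F / to_fract B = dehom m F * (to_fract (Z3 ^ m) / to_fract B)" for B
      using Z3_nz by (simp add: dehom_def to_fract_power)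
    then have "{to_fract F / to_fract B | B. homogeneous m B \<and> eval3 B v \<noteq> 0} = ?R"
      by (simp only:) blast
    finally show ?thesis .
  qed
  have Zp: "homogeneous m (Z3 ^ m)" "eval3 (Z3 ^ m) v \<noteq> 0" for m
    using \<gamma> by (auto intro: homogeneous_power)
  have unit: "dehom m F \<in> local_equations F p" if "homogeneous m F" "F \<noteq> 0" for m F
    unfolding eqs[OF that] using Zp[of m] Z3_nz by (auto simp: to_fract_power intro!: exI[of _ 1] exI[of _ "Z3 ^ m"])
  have mult: "\<exists>r\<in>local_ring p. f = r * dehom m F"
    if F: "homogeneous m F" "F \<noteq> 0" "f \<in> local_equations F p" for m F f
  proof -
    obtain B where "f = dehom m F * (to_fract (Z3 ^ m) / to_fract B)" "homogeneous m B" "eval3 B v \<noteq> 0"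
      using F(3) unfolding eqs[OF F(1,2)] by blast
    then show ?thesis
      using Zp[of m] by (intro bexI[of _ "to_fract (Z3 ^ m) / to_fract B"] local_ringI[of m]) simp_all
  qed
  show ?thesis
  proof (intro equalityI subsetI)
    fix z assume "z \<in> local_ideal F G p"
    then obtain a b f g where *: "z = a * f + b * g" "a \<in> local_ring p" "b \<in> local_ring p"
      "f \<in> local_equations F p" "g \<in> local_equations G p"
      unfolding local_ideal_def by blast
    obtain r s where "r \<in> local_ring p" "f = r * dehom m F" "s \<in> local_ring p" "g = s * dehom n G"
      using mult[OF F *(4)] mult[OF G *(5)] by blast
    with * show "z \<in> ideal2 (dehom m F) (dehom n G)"
      by (intro ideal2I[of "a * r" "b * s"]) (auto intro: mult_in)
  next
    fix z assume "z \<in> ideal2 (dehom m F) (dehom n G)"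
    then show "z \<in> local_ideal F G p"
      unfolding ideal2_def local_ideal_def using unit[OF F] unit[OF G] by blast
  qed
qed

end

section \<open>The Fermat curve\<close>

lemma eval3_fermat [simp]: "eval3 (fermat d) w = (w $ 1) ^ d + (w $ 2) ^ d + (w $ 3) ^ d"
  by (simp add: fermat_def)

lemma fermat_nonzero: "fermat d \<noteq> 0"
proof
  assume "fermat d = 0"
  then have "eval3 (fermat d) (vector [1, 0, 0]) = eval3 0 (vector [1, 0, 0])"
    "eval3 (fermat d) (vector [1, 1, 0]) = eval3 0 (vector [1, 1, 0])" by simp_all
  then show False by (cases "d = 0") (simp_all add: power_0_left)
qed

lemma homogeneous_fermat: "homogeneous d (fermat d)"
  unfolding fermat_def by (intro homogeneous_add homogeneous_power) simp_all

text \<open>The two power conditions say that the point lies on \<open>X3 ^ d = Y3 ^ d\<close> and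
  on the Fermat curve; no root of unity needs to be singled out.\<close>

locale fermat_point = affine_point +
  fixes d :: nat
  assumes d3: "3 \<le> d" and \<alpha>_power: "\<alpha> ^ d = 1" and \<gamma>_power: "\<gamma> ^ d = - 2"
begin

lemma \<alpha>: "\<alpha> \<noteq> 0"
  using \<alpha>_power d3 by (auto simp: power_0_left)

abbreviation K where "K \<equiv> const_fract"
text \<open>The scalars of \<open>xx\<close> and \<open>yy\<close> are the reciprocals of the values
  of the chart coordinates at the point, so both functions take the value 1 there.\<close>

definition xx where "xx = K (\<gamma> / \<alpha>) * (to_fract X3 / to_fract Z3)"
definition yy where "yy = K \<gamma> * (to_fract Y3 / to_fract Z3)"
definition a where "a = K (1 / 2) * (xx + yy) - 1"
definition b where "b = K (1 / 2) * (xx - yy)"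

lemma K_inverse: "c \<noteq> 0 \<Longrightarrow> K (1 / c) * (K c * x) = x" "c \<noteq> 0 \<Longrightarrow> K c * (K (1 / c) * x) = x"
  unfolding mult.assoc[symmetric] k_mult[symmetric] by (simp_all add: k_1)

lemma xx: "xx = 1 + a + b" and yy: "yy = 1 + a - b"
proof -
  have "K (1 / 2) + K (1 / 2) = 1" by (simp flip: k_add add: k_1)
  from arg_cong[OF this, of "\<lambda>c. c * z" for z]
  have *: "K (1 / 2) * z + K (1 / 2) * z = z" for z by (simp add: distrib_right)
  show "xx = 1 + a + b" "yy = 1 + a - b"
    using *[of xx] *[of yy] by (simp_all add: a_def b_def algebra_simps)
qed

lemma X_frac: "to_fract X3 / to_fract Z3 = K (\<alpha> / \<gamma>) * xx"
  and Y_frac: "to_fract Y3 / to_fract Z3 = K (1 / \<gamma>) * yy"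
proof -
  have "1 / (\<gamma> / \<alpha>) = \<alpha> / \<gamma>" "\<gamma> / \<alpha> \<noteq> 0" using \<alpha> \<gamma> by auto
  then show "to_fract X3 / to_fract Z3 = K (\<alpha> / \<gamma>) * xx" "to_fract Y3 / to_fract Z3 = K (1 / \<gamma>) * yy"
    using K_inverse(1)[of "\<gamma> / \<alpha>"] K_inverse(1)[OF \<gamma>] unfolding xx_def yy_def by metis+
qed

lemma xx_eq: "xx = to_fract (const3 (\<gamma> / \<alpha>) * X3) / to_fract Z3"
  and yy_eq: "yy = to_fract (const3 \<gamma> * Y3) / to_fract Z3"
  by (simp_all add: xx_def yy_def const_fract_def)

lemma xy_in: "xx \<in> local_ring p" "yy \<in> local_ring p"
  unfolding xx_eq yy_eq using \<gamma> by (intro local_ringI[of 1] homogeneous_const_mult; simp)+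

lemma xy_minus_1: "xx - 1 \<in> M" "yy - 1 \<in> M"
proof -
  have "xx - 1 = to_fract (const3 (\<gamma> / \<alpha>) * X3 - Z3) / to_fract Z3"
    "yy - 1 = to_fract (const3 \<gamma> * Y3 - Z3) / to_fract Z3"
    using Z3_nz by (simp_all add: xx_eq yy_eq diff_divide_distrib)
  moreover have "\<dots> \<in> M" "to_fract (const3 (\<gamma> / \<alpha>) * X3 - Z3) / to_fract Z3 \<in> M"
    using \<alpha> \<gamma> by (intro MI[of 1] homogeneous_diff homogeneous_const_mult; simp)+
  ultimately show "xx - 1 \<in> M" "yy - 1 \<in> M" by simp_all
qed

lemma a_eq: "a = K (1 / 2) * ((xx - 1) + (yy - 1))" and b_eq: "b = K (1 / 2) * ((xx - 1) - (yy - 1))"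
proof -
  have "K (1 / 2) * 2 = 1" using k_mult[of "1 / 2" 2] by (simp add: k_numeral k_1)
  moreover have "K (1 / 2) * ((xx - 1) + (yy - 1)) = K (1 / 2) * (xx + yy) - K (1 / 2) * 2"
    by (simp add: algebra_simps)
  ultimately show "a = K (1 / 2) * ((xx - 1) + (yy - 1))" by (simp only: a_def)
qed (simp add: b_def)

lemma ab_M: "a \<in> M" "b \<in> M"
  unfolding a_eq b_eq by (intro M_mult' M_add M_diff xy_minus_1 k_in)+

text \<open>In the chart a form is a polynomial in \<open>xx\<close> and \<open>yy\<close>, and both
  are congruent to 1 modulo \<open>a\<close> and \<open>b\<close>; hence it is congruent to its
  value at the point. For forms vanishing there this gives generators of \<open>M\<close>.\<close>

lemma dehom_cong:
  assumes "homogeneous n A"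
  shows "dehom n A - K (eval3 A v / \<gamma> ^ n) \<in> ideal2 a b"
  using assms
proof (induction A rule: homogeneous_induct)
  case (add F G)
  then have "(dehom n F - K (eval3 F v / \<gamma> ^ n)) + (dehom n G - K (eval3 G v / \<gamma> ^ n)) \<in> ideal2 a b"
    by (rule ideal2_add)
  then show ?case by (simp add: dehom_simps add_divide_distrib k_add algebra_simps)
next
  case (monom c i j l)
  have *: "K r * z - K r \<in> ideal2 a b" if "z - 1 \<in> ideal2 a b" for r z
    using ideal2_mult[OF k_in[of r] that] by (simp add: right_diff_distrib)
  have ab: "xx - 1 \<in> ideal2 a b" "yy - 1 \<in> ideal2 a b"
    using ideal2_gen by (auto simp: xx yy intro!: ideal2_add ideal2_diff)
  have "K c * (K (\<alpha> / \<gamma>) * xx) ^ i * (K (1 / \<gamma>) * yy) ^ j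
      - K c * K (\<alpha> / \<gamma>) ^ i * K (1 / \<gamma>) ^ j \<in> ideal2 a b"
    by (intro cong_mult cong_power * ab) (auto intro!: in_intros xy_in ideal2_zero)
  also have "K c * K (\<alpha> / \<gamma>) ^ i * K (1 / \<gamma>) ^ j = K (c * \<alpha> ^ i * \<gamma> ^ l / \<gamma> ^ n)"
    using \<gamma> monom by (auto simp: power_add power_divide simp flip: k_mult k_power)
  finally show ?case
    using monom by (simp add: dehom_monom X_frac Y_frac)
qed (simp add: dehom_simps k_0 ideal2_zero)

lemma M_generators: "M \<subseteq> ideal2 a b"
proof
  fix z assume "z \<in> M"
  then obtain A B n where *: "homogeneous n A" "homogeneous n B" "eval3 B v \<noteq> 0" "eval3 A v = 0"
    "z = to_fract A / to_fract B"
    unfolding M_def by blast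
  have "dehom n A \<in> ideal2 a b" using dehom_cong[OF *(1)] * by (simp add: k_0)
  moreover have "to_fract (Z3 ^ n) / to_fract B \<in> local_ring p"
    using * homogeneous_power[of Z3 n] by (intro local_ringI[of n]) simp_all
  moreover have "z = dehom n A * (to_fract (Z3 ^ n) / to_fract B)"
    using Z3_nz * by (simp add: dehom_def to_fract_power)
  ultimately show "z \<in> ideal2 a b" by (simp only: ideal2_mult')
qed

text \<open>Both scaling factors \<gamma>/\<alpha> and \<gamma> have \<open>d\<close>-th power -2,
  so the rescaling multiplies the whole equation by -2.\<close>

lemma dehom_fermat: "xx ^ d + yy ^ d - 2 = K (- 2) * dehom d (fermat d)"
proof -
  have "xx ^ d = K (- 2) * (to_fract X3 / to_fract Z3) ^ d"
    unfolding xx_def power_mult_distrib k_power[symmetric] power_divide[of \<gamma>] \<alpha>_power \<gamma>_power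
    by simp
  moreover have "yy ^ d = K (- 2) * (to_fract Y3 / to_fract Z3) ^ d"
    unfolding yy_def power_mult_distrib k_power[symmetric] \<gamma>_power ..
  moreover have "dehom d (fermat d) = (to_fract X3 / to_fract Z3) ^ d + (to_fract Y3 / to_fract Z3) ^ d + 1"
    using Z3_nz by (simp add: dehom_def fermat_def to_fract_power add_divide_distrib power_divide)
  ultimately show ?thesis
    by (simp add: distrib_left k_minus k_numeral)
qed

text \<open>
  Substituting \<open>z = \<gamma> y\<close> does not annihilate the Fermat polynomial, so the prime \<open>z - \<gamma> y\<close> does not divide it and can
  be cancelled from the right-hand side.
\<close>

lemma fermat_not_dvd_power:
  assumes "(Z3 - const3 \<gamma> * Y3) ^ i * H = fermat d * A"
  shows "eval3 H v = 0"
  using assms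
proof (induction i arbitrary: A)
  case 0
  then have "eval3 H v = eval3 (fermat d * A) v" by simp
  then show ?case by (simp add: \<alpha>_power \<gamma>_power)
next
  case (Suc i)
  \<comment> \<open>In the outermost variable \<open>Z3\<close> the linear form is monic with root
    \<open>c\<close>, so divisibility by it is tested by evaluating at \<open>c\<close>.\<close>
  define c :: "complex poly poly" where "c = [:0, [:\<gamma>:]:]"
  have W: "Z3 - const3 \<gamma> * Y3 = [:- c, 1:]"
    by (simp add: Z3_def Y3_def const3_def c_def)
  have "poly (fermat d * A) c = 0"
    unfolding Suc.prems[symmetric] W by simp
  moreover have "poly (fermat d) c \<noteq> 0"
  proof
    assume "poly (fermat d) c = 0"
    \<comment> \<open>At \<open>Y3 = 1\<close> and \<open>X3 = 0\<close> the substituted polynomial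
      has the value \<open>1 + \<gamma> ^ d = - 1\<close>.\<close>
    then have "poly (poly (poly (fermat d) c) [:1:]) 0 = 0" by simp
    then show False
      using d3 by (simp add: fermat_def X3_def Y3_def Z3_def c_def \<gamma>_power power_0_left)
  qed
  ultimately have "[:- c, 1:] dvd A" by (simp add: poly_eq_0_iff_dvd)
  then obtain A' where A': "A = [:- c, 1:] * A'" by blast
  have "[:- c, 1:] * ((Z3 - const3 \<gamma> * Y3) ^ i * H) = [:- c, 1:] * (fermat d * A')"
    using Suc.prems unfolding W A' by (simp only: power_Suc mult_ac)
  then have "(Z3 - const3 \<gamma> * Y3) ^ i * H = fermat d * A'"
    by (simp only: mult_cancel_left) simp
  then show ?case by (rule Suc.IH)
qed

sublocale fermat_branch "local_ring p" M const_fract a b d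
proof
  \<comment> \<open>\<open>h\<close> cuts out a line through the point. Clearing denominators in a
    supposed relation puts it in the form excluded by \<open>fermat_not_dvd_power\<close>, since
    \<open>Z3 ^ d * B\<close> does not vanish at \<open>v\<close>.\<close>
  define h where "h = to_fract (Z3 - const3 \<gamma> * Y3) / to_fract Y3"
  have "h \<in> M"
    unfolding h_def by (intro MI[of 1] homogeneous_diff homogeneous_const_mult) simp_all
  moreover have False if x: "x \<in> local_ring p" "h ^ i = (xx ^ d + yy ^ d - 2) * x" for i x
  proof -
    obtain A B where *: "eval3 B v \<noteq> 0" "x = to_fract A / to_fract B"
      using x unfolding local_ring_p by blast
    have "to_fract ((Z3 - const3 \<gamma> * Y3) ^ i * (Z3 ^ d * B)) = to_fract (fermat d * (const3 (- 2) * Y3 ^ i * A))"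
      using x(2) Z3_nz eval3_nonzero[OF *(1)] unfolding dehom_fermat
      by (simp add: * h_def dehom_def to_fract_power power_divide const_fract_def frac_eq_eq mult_ac)
    then have "eval3 (Z3 ^ d * B) v = 0"
      unfolding to_fract_eq_iff by (rule fermat_not_dvd_power)
    with * \<gamma> show False by simp
  qed
  ultimately show "\<exists>h\<in>M. \<forall>i. \<forall>x\<in>local_ring p. h ^ i \<noteq> ((1 + a + b) ^ d + (1 + a - b) ^ d - 2) * x"
    unfolding xx[symmetric] yy[symmetric] by blast
qed (use d3 ab_M M_generators in auto)

section \<open>Intersection multiplicity as order of vanishing along the branch\<close>

lemma local_ideal_fermat:
  assumes "homogeneous n Q" "Q \<noteq> 0"
  shows "local_ideal Q (fermat d) p = ideal2 (dehom n Q) f"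
proof -
  have f: "f = K (- 2) * dehom d (fermat d)"
    using dehom_fermat by (simp add: f_def xx yy)
  then have f': "dehom d (fermat d) = K (- (1 / 2)) * f"
    using K_inverse(1)[of "- 2"] by simp
  have "dehom d (fermat d) \<in> ideal2 (dehom n Q) f"
    unfolding f' by (intro ideal2_mult k_in ideal2_gen)
  moreover have "f \<in> ideal2 (dehom n Q) (dehom d (fermat d))"
    unfolding f by (intro ideal2_mult k_in ideal2_gen)
  ultimately show ?thesis
    unfolding local_ideal_eq[OF assms homogeneous_fermat fermat_nonzero]
    using ideal2_subset ideal2_gen by blast
qed

text \<open>When \<open>Q\<close> restricts to a unit times \<open>b ^ m\<close> on the curve,
  \<open>linear_relation_mod\<close> bounds every independent family by \<open>m\<close>
  elements.\<close>

lemma intersection_mult_le: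
  assumes "homogeneous n Q" "Q \<noteq> 0"
    and "dehom n Q - b ^ m * u \<in> ideal2 0 f" "u \<in> local_ring p" "u \<notin> M"
  shows "intersection_mult Q (fermat d) p \<le> enat m"
  unfolding intersection_mult_def
proof (rule Sup_least)
  fix e assume "e \<in> {enat (card S) | S. finite S \<and> S \<subseteq> local_ring p
    \<and> independent_mod (local_ideal Q (fermat d) p) S}"
  then obtain S where S: "e = enat (card S)" "finite S" "S \<subseteq> local_ring p"
    "independent_mod (ideal2 (dehom n Q) f) S"
    unfolding local_ideal_fermat[OF assms(1,2)] by blast
  have "\<not> m < card S"
    using linear_relation_mod[OF assms(3-5) S(2,3)] S(4)
    unfolding independent_mod_def const_fract_def by blast
  then show "e \<le> enat m" using S by simp
qed

text \<open>The powers of \<open>b\<close> below \<open>b ^ m\<close> are independent modulo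
  \<open>b ^ m\<close> and \<open>f\<close>, hence also modulo the smaller ideal generated by
  \<open>dehom n Q\<close> and \<open>f\<close>.\<close>

lemma intersection_mult_ge:
  assumes "homogeneous n Q" "Q \<noteq> 0" and "dehom n Q \<in> ideal2 (b ^ m) f"
  shows "enat m \<le> intersection_mult Q (fermat d) p"
proof -
  let ?S = "(\<lambda>i. b ^ i) ` {..<m}"
  have inj: "inj_on (\<lambda>i. b ^ i) {..<m}"
    using inj_powers by (rule inj_on_subset) simp
  have "independent_mod (local_ideal Q (fermat d) p) ?S"
    unfolding independent_mod_def local_ideal_fermat[OF assms(1,2)]
  proof (intro allI impI)
    fix c assume "(\<Sum>s\<in>?S. to_fract (const3 (c s)) * s) \<in> ideal2 (dehom n Q) f"
    then have "(\<Sum>i<m. K (c (b ^ i)) * b ^ i) \<in> ideal2 (dehom n Q) f"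
      unfolding sum.reindex[OF inj] by (simp add: const_fract_def)
    then have "(\<Sum>i<m. K (c (b ^ i)) * b ^ i) \<in> ideal2 (b ^ m) f"
      using ideal2_subset[OF assms(3) ideal2_gen(2)] by blast
    from powers_independent[OF this] show "\<forall>s\<in>?S. c s = 0" by blast
  qed
  moreover have "?S \<subseteq> local_ring p" using ab_in by (auto intro: in_intros)
  moreover have "card ?S = m" using inj by (simp add: card_image)
  ultimately have "enat m \<in> {enat (card S) | S. finite S \<and> S \<subseteq> local_ring p
    \<and> independent_mod (local_ideal Q (fermat d) p) S}"
    by (intro CollectI exI[of _ ?S]) auto
  then show ?thesis unfolding intersection_mult_def by (rule Sup_upper)
qed

end

section \<open>The gradient of the Fermat polynomial\<close>

lemma eval3_dX_fermat: "eval3 (dX (fermat d)) w = of_nat d * (w $ 1) ^ (d - 1)"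
  and eval3_dY_fermat: "eval3 (dY (fermat d)) w = of_nat d * (w $ 2) ^ (d - 1)"
  and eval3_dZ_fermat: "eval3 (dZ (fermat d)) w = of_nat d * (w $ 3) ^ (d - 1)"
proof -
  have x: "X3 ^ d = [:[:monom 1 d:]:]"
    by (simp add: X3_power monom_altdef)
  have y: "Y3 ^ d = [:monom 1 d:]"
    by (simp add: Y3_power monom_altdef)
  have z: "Z3 ^ d = monom 1 d"
    by (simp add: Z3_def monom_altdef)
  have map_add: "map_poly g (F + G) = map_poly g F + map_poly g G"
    if "g 0 = 0" "\<And>x y. g (x + y) = g x + g y" for g :: "'b::comm_monoid_add \<Rightarrow> 'c::comm_monoid_add" and F G
    using that by (intro poly_eqI) (simp add: coeff_map_poly)
  have mp: "map_poly pderiv (F + G) = map_poly pderiv F + map_poly pderiv G" for F G :: "'b::idom poly poly"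
    by (rule map_add) (simp_all add: pderiv_add)
  have mmp: "map_poly (map_poly pderiv) (F + G) = map_poly (map_poly pderiv) F + map_poly (map_poly pderiv) G"
    for F G :: poly3
    by (rule map_add) (simp_all add: mp)
  have "dX (fermat d) = [:[:pderiv (monom 1 d):]:]"
    unfolding dX_def fermat_def mmp unfolding x y z
    by (simp add: map_poly_pCons map_poly_monom map_poly_1)
  then show "eval3 (dX (fermat d)) w = of_nat d * (w $ 1) ^ (d - 1)"
    by (simp add: eval3_def pderiv_monom poly_monom)
  have "dY (fermat d) = [:pderiv (monom 1 d):]"
    unfolding dY_def fermat_def mp unfolding x y z
    by (simp add: map_poly_pCons map_poly_monom)
  then show "eval3 (dY (fermat d)) w = of_nat d * (w $ 2) ^ (d - 1)"
    by (simp add: eval3_def pderiv_monom poly_monom of_nat_poly)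
  have "dZ (fermat d) = pderiv (monom 1 d)"
    unfolding dZ_def fermat_def pderiv_add unfolding x y z by simp
  then show "eval3 (dZ (fermat d)) w = of_nat d * (w $ 3) ^ (d - 1)"
    by (simp add: eval3_def pderiv_monom poly_monom of_nat_poly)
qed

section \<open>The stated conic, its uniqueness, and the tangent line\<close>

context fermat_point begin

text \<open>This is the polynomial of the theorem, with \<alpha> in place of
  \<open>\<zeta> ^ j\<close> and \<gamma> in place of the last coordinate of the point.\<close>

definition hyp :: poly3 where
  "hyp = (let D = of_nat d in
       const3 (D * (D + 1) / \<alpha>\<^sup>2) * X3 ^ 2
     + const3 (D * (D + 1)) * Y3 ^ 2
     - const3 (4 * (D + 1) * (2 * D - 3) / \<gamma>\<^sup>2) * Z3 ^ 2
     - const3 (2 * (D - 2) * (5 * D - 3) / \<alpha>) * (X3 * Y3)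
     + const3 (8 * D * (D - 2) / (\<alpha> * \<gamma>)) * (X3 * Z3)
     + const3 (8 * D * (D - 2) / \<gamma>) * (Y3 * Z3))"

lemma homogeneous_hyp: "homogeneous 2 hyp"
proof -
  have "homogeneous 2 (F * G)" if "homogeneous 1 F" "homogeneous 1 G" for F G
    using homogeneous_mult[OF that] by (simp add: numeral_2_eq_2)
  then show ?thesis
    unfolding hyp_def Let_def
    by (intro homogeneous_add homogeneous_diff homogeneous_const_mult homogeneous_power) simp_all
qed

lemma hyp_nonzero: "hyp \<noteq> 0"
proof (rule eval3_nonzero)
  have "of_nat d * (of_nat d + 1) = (of_nat (d * (d + 1)) :: complex)" by (simp add: algebra_simps)
  also have "\<dots> \<noteq> 0" using d3 by (subst of_nat_eq_0_iff) simp
  finally show "eval3 hyp (vector [0, 1, 0]) \<noteq> 0"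
    by (simp add: hyp_def Let_def)
qed

lemma dehom_X: "dehom 1 X3 = K (\<alpha> / \<gamma>) * xx" and dehom_Y: "dehom 1 Y3 = K (1 / \<gamma>) * yy"
  by (simp_all add: dehom_def X_frac Y_frac)

lemma dehom_products:
  "dehom 2 (X3 ^ 2) = K ((\<alpha> / \<gamma>)\<^sup>2) * xx\<^sup>2" "dehom 2 (Y3 ^ 2) = K ((1 / \<gamma>)\<^sup>2) * yy\<^sup>2"
  "dehom 2 (Z3 ^ 2) = 1" "dehom 2 (X3 * Y3) = K (\<alpha> / \<gamma> * (1 / \<gamma>)) * (xx * yy)"
  "dehom 2 (X3 * Z3) = K (\<alpha> / \<gamma>) * xx" "dehom 2 (Y3 * Z3) = K (1 / \<gamma>) * yy"
proof -
  have *: "dehom 2 (F * G) = dehom 1 F * dehom 1 G" for F G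
    using dehom_simps(4)[of 1 1] by (simp add: numeral_2_eq_2)
  show "dehom 2 (X3 ^ 2) = K ((\<alpha> / \<gamma>)\<^sup>2) * xx\<^sup>2" "dehom 2 (Y3 ^ 2) = K ((1 / \<gamma>)\<^sup>2) * yy\<^sup>2"
    "dehom 2 (Z3 ^ 2) = 1" "dehom 2 (X3 * Y3) = K (\<alpha> / \<gamma> * (1 / \<gamma>)) * (xx * yy)"
    "dehom 2 (X3 * Z3) = K (\<alpha> / \<gamma>) * xx" "dehom 2 (Y3 * Z3) = K (1 / \<gamma>) * yy"
    unfolding power2_eq_square * dehom_X dehom_Y dehom_simps(6) k_mult by (simp_all only: mult_ac mult_1_right mult_1_left)
qed

text \<open>The powers of \<alpha> and \<gamma> in the coefficients match the scaling of
  \<open>xx\<close> and \<open>yy\<close>, so every term carries the factor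
  \<open>1 / \<gamma>\<^sup>2\<close>. After substituting \<open>xx = 1 + a + b\<close> and
  \<open>yy = 1 + a - b\<close> the constant term cancels, and symmetry removes the terms odd in
  \<open>b\<close>.\<close>

lemma dehom_hyp: "dehom 2 hyp = K (4 / \<gamma>\<^sup>2) * osc"
proof -
  define E :: "poly3 fract" where "E = of_nat d"
  have comb: "K (c / e) * (K e' * z) = K (1 / \<gamma>\<^sup>2) * (K c * z)" if "e' / e = 1 / \<gamma>\<^sup>2" for c e e' z
  proof -
    have "c / e * e' = 1 / \<gamma>\<^sup>2 * c" using that by (metis mult.commute times_divide_eq_left times_divide_eq_right)
    then show ?thesis by (simp only: mult.assoc[symmetric] k_mult[symmetric])
  qed
  have c1: "(\<alpha> / \<gamma>)\<^sup>2 / \<alpha>\<^sup>2 = 1 / \<gamma>\<^sup>2" "(1 / \<gamma>)\<^sup>2 / 1 = 1 / \<gamma>\<^sup>2" "1 / \<gamma>\<^sup>2 = 1 / \<gamma>\<^sup>2"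
    "\<alpha> / \<gamma> * (1 / \<gamma>) / \<alpha> = 1 / \<gamma>\<^sup>2" "\<alpha> / \<gamma> / (\<alpha> * \<gamma>) = 1 / \<gamma>\<^sup>2" "1 / \<gamma> / \<gamma> = 1 / \<gamma>\<^sup>2"
    using \<alpha> \<gamma> by (simp_all add: field_simps power2_eq_square)
  note cs = comb[OF c1(1)] comb[OF c1(2), unfolded div_by_1] comb[OF c1(3), unfolded k_1 mult_1]
    comb[OF c1(4)] comb[OF c1(5)] comb[OF c1(6)]
  have z: "K (c / \<gamma>\<^sup>2) * 1 = K (1 / \<gamma>\<^sup>2) * (K c * 1)" for c
    by (rule cs(3))
  have "dehom 2 hyp = K (1 / \<gamma>\<^sup>2) * (K (of_nat d * (of_nat d + 1)) * xx\<^sup>2)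
      + K (1 / \<gamma>\<^sup>2) * (K (of_nat d * (of_nat d + 1)) * yy\<^sup>2)
      - K (1 / \<gamma>\<^sup>2) * (K (4 * (of_nat d + 1) * (2 * of_nat d - 3)) * 1)
      - K (1 / \<gamma>\<^sup>2) * (K (2 * (of_nat d - 2) * (5 * of_nat d - 3)) * (xx * yy))
      + K (1 / \<gamma>\<^sup>2) * (K (8 * of_nat d * (of_nat d - 2)) * xx)
      + K (1 / \<gamma>\<^sup>2) * (K (8 * of_nat d * (of_nat d - 2)) * yy)"
    unfolding hyp_def Let_def dehom_simps(2,3,5) dehom_products cs(1,2,4,5,6) z ..
  also have "\<dots> = K (1 / \<gamma>\<^sup>2) * (E * (E + 1) * (xx\<^sup>2 + yy\<^sup>2) - 4 * (E + 1) * (2 * E - 3)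
      - 2 * (E - 2) * (5 * E - 3) * (xx * yy) + 8 * E * (E - 2) * (xx + yy))"
    unfolding E_def k_mult k_add k_diff k_of_nat k_1 k_numeral by (simp add: algebra_simps)
  also have "E * (E + 1) * (xx\<^sup>2 + yy\<^sup>2) - 4 * (E + 1) * (2 * E - 3)
      - 2 * (E - 2) * (5 * E - 3) * (xx * yy) + 8 * E * (E - 2) * (xx + yy) = 4 * osc"
    unfolding xx yy osc_def E_def[symmetric] by (simp add: power2_eq_square algebra_simps)
  also have "K (1 / \<gamma>\<^sup>2) * (4 * osc) = K (4 / \<gamma>\<^sup>2) * osc"
    using k_mult[of "1 / \<gamma>\<^sup>2" 4] by (simp add: k_numeral)
  finally show ?thesis .
qed

lemma intersection_mult_hyp: "6 \<le> intersection_mult hyp (fermat d) p"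
proof -
  have "dehom 2 hyp \<in> ideal2 (b ^ 6) f"
    unfolding dehom_hyp by (intro ideal2_mult k_in osc_in_ideal)
  from intersection_mult_ge[OF homogeneous_hyp hyp_nonzero this] show ?thesis
    by (simp add: numeral_eq_enat)
qed

text \<open>A monomial of degree 2 becomes a multiple of one of \<open>1\<close>, \<open>xx\<close>,
  \<open>yy\<close>, \<open>xx\<^sup>2\<close>, \<open>xx * yy\<close>, \<open>yy\<^sup>2\<close>;
  the witnesses are the coefficients of its expansion in \<open>a\<close> and
  \<open>b\<close>.\<close>

lemma dehom_quadric:
  assumes "homogeneous 2 Q"
  shows "\<exists>s0 s1 s2 s3 s4 s5. dehom 2 Q
    = K s0 + K s1 * b + K s2 * b\<^sup>2 + K s3 * a + K s4 * (a * b) + K s5 * a\<^sup>2"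
  using assms
proof (induction Q rule: homogeneous_induct)
  case zero
  show ?case by (intro exI[of _ 0]) (simp add: dehom_simps k_0)
next
  case (add F G)
  then obtain s0 s1 s2 s3 s4 s5 t0 t1 t2 t3 t4 t5 where
    "dehom 2 F = K s0 + K s1 * b + K s2 * b\<^sup>2 + K s3 * a + K s4 * (a * b) + K s5 * a\<^sup>2"
    "dehom 2 G = K t0 + K t1 * b + K t2 * b\<^sup>2 + K t3 * a + K t4 * (a * b) + K t5 * a\<^sup>2"
    by blast
  then have "dehom 2 (F + G) = K (s0 + t0) + K (s1 + t1) * b + K (s2 + t2) * b\<^sup>2 + K (s3 + t3) * a
      + K (s4 + t4) * (a * b) + K (s5 + t5) * a\<^sup>2"
    by (simp add: dehom_simps k_add distrib_right)
  then show ?case by blast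
next
  case (monom c i j l)
  define c' where "c' = c * (\<alpha> / \<gamma>) ^ i * (1 / \<gamma>) ^ j"
  have eq: "dehom 2 (const3 c * X3 ^ i * Y3 ^ j * Z3 ^ l) = K c' * (xx ^ i * yy ^ j)"
    unfolding dehom_monom[OF monom] X_frac Y_frac c'_def k_mult k_power power_mult_distrib
    by (simp only: mult_ac)
  have K2: "K (2 * c') = 2 * K c'" "K (c' * 2) = 2 * K c'" "K (- (2 * c')) = - (2 * K c')"
    "K (- (c' * 2)) = - (2 * K c')" "K (- c') = - K c'"
    by (simp_all add: k_mult k_numeral k_minus)
  consider "i = 0" "j = 0" | "i = 1" "j = 0" | "i = 0" "j = 1" | "i = 2" "j = 0"
    | "i = 1" "j = 1" | "i = 0" "j = 2"
    using monom by linarith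
  then show ?case
  proof cases
    case 1
    show ?thesis unfolding eq unfolding 1
      by (rule exI[of _ c'], (rule exI[of _ 0])+) (simp add: k_0)
  next
    case 2
    show ?thesis unfolding eq unfolding 2
      by (rule exI[of _ c'], rule exI[of _ c'], rule exI[of _ 0], rule exI[of _ c'], (rule exI[of _ 0])+)
        (simp add: k_0 xx algebra_simps)
  next
    case 3
    show ?thesis unfolding eq unfolding 3
      by (rule exI[of _ c'], rule exI[of _ "- c'"], rule exI[of _ 0], rule exI[of _ c'], (rule exI[of _ 0])+)
        (simp add: k_0 yy K2 algebra_simps)
  next
    case 4
    show ?thesis unfolding eq unfolding 4
      by (rule exI[of _ c'], rule exI[of _ "2 * c'"], rule exI[of _ c'], rule exI[of _ "2 * c'"],
          rule exI[of _ "2 * c'"], rule exI[of _ c'])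
        (simp add: xx K2 power2_eq_square algebra_simps)
  next
    case 5
    show ?thesis unfolding eq unfolding 5
      by (rule exI[of _ c'], rule exI[of _ 0], rule exI[of _ "- c'"], rule exI[of _ "2 * c'"],
          rule exI[of _ 0], rule exI[of _ c'])
        (simp add: k_0 xx yy K2 power2_eq_square algebra_simps)
  next
    case 6
    show ?thesis unfolding eq unfolding 6
      by (rule exI[of _ c'], rule exI[of _ "- 2 * c'"], rule exI[of _ c'], rule exI[of _ "2 * c'"],
          rule exI[of _ "- 2 * c'"], rule exI[of _ c'])
        (simp add: yy K2 power2_eq_square algebra_simps)
  qed
qed

text \<open>The term in \<open>b\<^sup>2\<close> is traded for a multiple of \<open>osc\<close>. A
  nonzero coefficient among the other five would, by \<open>conic_order\<close>, force multiplicity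
  at most 4.\<close>

lemma conic_unique:
  assumes "conic Q" "5 \<le> intersection_mult Q (fermat d) p"
  shows "\<exists>c. c \<noteq> 0 \<and> Q = const3 c * hyp"
proof -
  have Q: "homogeneous 2 Q" "Q \<noteq> 0" using assms(1) by (auto simp: conic_def)
  obtain s0 s1 s2 s3 s4 s5 where s: "dehom 2 Q
    = K s0 + K s1 * b + K s2 * b\<^sup>2 + K s3 * a + K s4 * (a * b) + K s5 * a\<^sup>2"
    using dehom_quadric[OF Q(1)] by blast
  define E :: complex where "E = of_nat d"
  have "E \<noteq> 1" using d3 by (simp add: E_def)
  \<comment> \<open>\<open>c\<close> matches the coefficient \<open>3 * (E - 1)\<^sup>2\<close> of
    \<open>b\<^sup>2\<close> in \<open>osc\<close>; \<open>r2\<close> and \<open>r4\<close> are what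
    then remains of the coefficients of \<open>a\<close> and \<open>a\<^sup>2\<close>.\<close>
  define c where "c = s2 / (3 * (E - 1)\<^sup>2)"
  define r2 where "r2 = s3 - 6 * c * (E - 1)"
  define r4 where "r4 = s5 + c * (2 * E - 1) * (E - 3)"
  have s_eq: "s2 = c * (3 * (E - 1)\<^sup>2)" "s3 = r2 + 6 * c * (E - 1)" "s5 = r4 - c * (2 * E - 1) * (E - 3)"
    using \<open>E \<noteq> 1\<close> by (simp_all add: c_def r2_def r4_def)
  have KE: "K E = of_nat d" by (simp add: E_def k_of_nat)
  have q: "dehom 2 Q = K c * osc + (K s0 + K s1 * b + K r2 * a + K s4 * (a * b) + K r4 * a\<^sup>2)"
    unfolding s s_eq osc_def k_add k_mult k_diff k_power k_1 k_numeral KE by (simp add: algebra_simps)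
  have "s0 = 0 \<and> s1 = 0 \<and> r2 = 0 \<and> s4 = 0 \<and> r4 = 0"
  proof (rule ccontr)
    assume "\<not> ?thesis"
    then obtain n u where "n \<le> 4" "u \<in> local_ring p" "u \<notin> M" "dehom 2 Q - b ^ n * u \<in> ideal2 0 f"
      using conic_order[OF q] by blast
    then have "intersection_mult Q (fermat d) p \<le> enat n" "n \<le> 4"
      using intersection_mult_le[OF Q] by blast+
    with assms(2) have "enat 5 \<le> enat n" by (metis numeral_eq_enat order_trans)
    with \<open>n \<le> 4\<close> show False by simp
  qed
  then have "dehom 2 Q = K c * osc" by (simp add: q k_0)
  \<comment> \<open>The scalar undoes the factor \<open>4 / \<gamma>\<^sup>2\<close> of
    \<open>dehom_hyp\<close>.\<close>
  also have "\<dots> = dehom 2 (const3 (c * \<gamma>\<^sup>2 / 4) * hyp)"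
  proof -
    have "c * \<gamma>\<^sup>2 / 4 * (4 / \<gamma>\<^sup>2) = c" using \<gamma> by simp
    then show ?thesis
      unfolding dehom_simps(5) dehom_hyp mult.assoc[symmetric] k_mult[symmetric] by simp
  qed
  finally have Q_eq: "Q = const3 (c * \<gamma>\<^sup>2 / 4) * hyp" by (rule dehom_inj)
  with Q(2) have "c * \<gamma>\<^sup>2 / 4 \<noteq> 0" by (metis const3_hom(1) mult_zero_left)
  with Q_eq show ?thesis by blast
qed

lemma hyperosculating_hyp: "hyperosculating_conic (fermat d) p hyp"
proof -
  have "(5 :: enat) \<le> 6" by simp
  from order_trans[OF this intersection_mult_hyp] show ?thesis
    unfolding hyperosculating_conic_def osculating_conic_def
    using intersection_mult_hyp conic_unique homogeneous_hyp hyp_nonzero by (auto simp: conic_def)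
qed

text \<open>In the chart the tangent line is a nonzero multiple of \<open>a\<close>, which by
  \<open>a_cong\<close> has order exactly 2 along the curve.\<close>

lemma not_inflection: "\<not> inflection_point (fermat d) p"
proof
  assume "inflection_point (fermat d) p"
  then obtain L w where L: "3 \<le> intersection_mult L (fermat d) p" "represents w p"
    "L = const3 (eval3 (dX (fermat d)) w) * X3 + const3 (eval3 (dY (fermat d)) w) * Y3
       + const3 (eval3 (dZ (fermat d)) w) * Z3"
    unfolding inflection_point_def tangent_line_def by blast
  obtain l where l: "l \<noteq> 0" "w = l *s v"
    using L(2) unfolding represents_hpoint_iff v_def by blast
  \<comment> \<open>Changing the representative by \<open>l\<close> only scales the gradient;
    \<open>g\<close> absorbs this factor together with the \<open>d\<close> from
    differentiation.\<close>
  define g where "g = of_nat d * l ^ (d - 1)"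
  have "g \<noteq> 0" using l d3 by (simp add: g_def)
  have L_eq: "L = const3 (g * \<alpha> ^ (d - 1)) * X3 + const3 g * Y3 + const3 (g * \<gamma> ^ (d - 1)) * Z3"
    unfolding L(3) eval3_dX_fermat eval3_dY_fermat eval3_dZ_fermat
    by (simp add: l(2) g_def power_mult_distrib mult.assoc)
  have hom: "homogeneous 1 L"
    unfolding L_eq by (intro homogeneous_add homogeneous_const_mult) simp_all
  have "eval3 L (vector [0, 1, 0]) \<noteq> 0" using \<open>g \<noteq> 0\<close> by (simp add: L_eq)
  then have "L \<noteq> 0" by (rule eval3_nonzero)
  \<comment> \<open>The gradient is thus proportional to
    \<open>(1 / \<alpha>, 1, - 2 / \<gamma>)\<close>, which in the chart gives a multiple of
    \<open>xx + yy - 2\<close>, that is, of \<open>2 * a\<close>.\<close>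
  have pow: "\<alpha> ^ (d - 1) = 1 / \<alpha>" "\<gamma> ^ (d - 1) = - 2 / \<gamma>"
    using \<alpha>_power \<gamma>_power \<alpha> \<gamma> d3 by (simp_all add: power_diff)
  have coef: "g * \<alpha> ^ (d - 1) * (\<alpha> / \<gamma>) = g / \<gamma>" "g * (1 / \<gamma>) = g / \<gamma>" "g * \<gamma> ^ (d - 1) = g / \<gamma> * (- 2)"
    using \<alpha> unfolding pow by simp_all
  have "dehom 1 L = K (g * \<alpha> ^ (d - 1) * (\<alpha> / \<gamma>)) * xx + K (g * (1 / \<gamma>)) * yy + K (g * \<gamma> ^ (d - 1))"
    unfolding L_eq dehom_simps(2,5,6) dehom_X dehom_Y k_mult by (simp only: mult.assoc mult_1_right)
  also have "\<dots> = K (g / \<gamma>) * (2 * a)"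
    unfolding coef k_mult[of "g / \<gamma>"] k_minus k_numeral xx yy by (simp only: algebra_simps) simp
  also have "\<dots> = K (g / \<gamma> * 2) * a"
    by (simp only: k_mult k_numeral mult.assoc)
  finally have dL: "dehom 1 L = K (g / \<gamma> * 2) * a" .
  obtain e where e: "e \<in> local_ring p" "e \<notin> M" "a - b\<^sup>2 * e \<in> ideal2 0 f"
    using a_cong by blast
  have "dehom 1 L - b\<^sup>2 * (K (g / \<gamma> * 2) * e) = K (g / \<gamma> * 2) * (a - b\<^sup>2 * e)"
    unfolding dL by (simp add: algebra_simps)
  also have "\<dots> \<in> ideal2 0 f" by (rule ideal2_mult[OF k_in e(3)])
  finally have order: "dehom 1 L - b\<^sup>2 * (K (g / \<gamma> * 2) * e) \<in> ideal2 0 f" .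
  have "K (g / \<gamma> * 2) * e \<notin> M"
    using \<open>g \<noteq> 0\<close> \<gamma> e by (intro unit_mult k_unit k_in) simp_all
  then have "intersection_mult L (fermat d) p \<le> enat 2"
    using intersection_mult_le[OF hom \<open>L \<noteq> 0\<close> order] e by (simp add: mult_in k_in)
  with L(1) have "enat 3 \<le> enat 2" by (metis numeral_eq_enat order_trans)
  then show False by simp
qed

lemma sextactic: "sextactic_point (fermat d) p"
  unfolding sextactic_point_def vanishes_at_p[OF homogeneous_fermat]
  using not_inflection hyperosculating_hyp by (auto simp: \<alpha>_power \<gamma>_power)

lemma hyperosculating_unique:
  assumes "hyperosculating_conic (fermat d) p Q"
  shows "zero_set Q = zero_set hyp"
proof -
  obtain c where "c \<noteq> 0" "Q = const3 c * hyp"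
    using assms conic_unique unfolding hyperosculating_conic_def osculating_conic_def by blast
  then show ?thesis by (simp add: zero_set_def vanishes_at_def)
qed

lemma point_in_zero_set: "p \<in> zero_set (X3 ^ d - Y3 ^ d)"
proof -
  have "homogeneous d (X3 ^ d - Y3 ^ d)"
    by (intro homogeneous_diff homogeneous_power) simp_all
  then show ?thesis by (simp add: zero_set_def vanishes_at_p \<alpha>_power)
qed

end

section \<open>Return to the coordinates of the statement\<close>

theorem corollary2p4:
  fixes d j k :: nat and u \<zeta> :: complex
  assumes "d \<ge> 3"
    and "primitive_root_of_unity (2 * d) u"
    and "primitive_root_of_unity d \<zeta>"
    and "j < d"
    and "odd k" and "0 < k" and "k < 2 * d"
  shows "sextactic_point (fermat d) (s_point d \<zeta> u j k)
    \<and> s_point d \<zeta> u j k \<in> zero_set (X3 ^ d - Y3 ^ d)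
    \<and> hyperosculating_conic (fermat d) (s_point d \<zeta> u j k) (O_conic d \<zeta> u j k)
    \<and> (\<forall>Q. hyperosculating_conic (fermat d) (s_point d \<zeta> u j k) Q
          \<longrightarrow> zero_set Q = zero_set (O_conic d \<zeta> u j k))"
proof -
  define r where "r = complex_of_real (root d 2)"
  define \<alpha> where "\<alpha> = \<zeta> ^ j"
  define \<gamma> where "\<gamma> = r / u ^ k"
  have d: "0 < d" using assms(1) by simp
  have r: "r ^ d = 2" "r \<noteq> 0"
    using d by (simp_all add: r_def flip: of_real_power)
  have u: "u ^ (2 * d) = 1" "u ^ d \<noteq> 1" and \<zeta>: "\<zeta> ^ d = 1"
    using assms(2,3) d unfolding primitive_root_of_unity_def by auto
  \<comment> \<open>The square of \<open>u ^ d\<close> is 1, and primitivity of \<open>u\<close>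
    excludes the value 1.\<close>
  have "u ^ d = - 1"
    using u by (metis mult.commute power2_eq_1_iff power_mult)
  have "u \<noteq> 0" using u d by (auto simp: power_0_left)
  have "\<alpha> ^ d = 1"
    by (simp add: \<alpha>_def \<zeta> flip: power_mult mult.commute[of d]) (simp add: power_mult \<zeta>)
  have "(u ^ k) ^ d = (u ^ d) ^ k"
    by (simp flip: power_mult add: mult.commute)
  \<comment> \<open>An odd \<open>k\<close> makes the denominator \<open>(u ^ d) ^ k\<close> equal
    to -1, which puts the point on the curve.\<close>
  then have "\<gamma> ^ d = - 2"
    using \<open>odd k\<close> by (simp add: \<gamma>_def power_divide r \<open>u ^ d = - 1\<close>)
  interpret fermat_point \<alpha> \<gamma> d
    using assms(1) r \<open>u \<noteq> 0\<close> \<open>\<alpha> ^ d = 1\<close> \<open>\<gamma> ^ d = - 2\<close> by unfold_locales (simp_all add: \<gamma>_def)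
  have s: "s_point d \<zeta> u j k = hpoint \<alpha> 1 \<gamma>"
    by (simp add: s_point_def \<alpha>_def \<gamma>_def r_def power_int_minus divide_inverse mult.commute)
  have pi: "\<zeta> powi (- 2 * int j) = 1 / \<alpha>\<^sup>2" "\<zeta> powi (- int j) = 1 / \<alpha>"
    "r powi (- 2) = 1 / r\<^sup>2" "r powi (- 1) = 1 / r"
    using power_int_of_nat[of \<zeta> "2 * j"]
    by (simp_all add: \<alpha>_def power_int_minus divide_inverse power_mult[symmetric] mult.commute)
  have O: "O_conic d \<zeta> u j k = hyp"
    unfolding O_conic_def hyp_def Let_def r_def[symmetric] pi
    by (simp add: \<gamma>_def power_divide power_mult[symmetric] mult.commute)
  show ?thesis
    unfolding s O
    using sextactic point_in_zero_set hyperosculating_hyp hyperosculating_unique by blast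
qed

end
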